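(* Let $p\in\mathbb{C}[z_1,z_2]$ be a complex conic. (1) The number of unbounded components in $\mathcal{I}(p)^{\mathsf c}$ can be any integer $0\le k\le 4$, and up to $4$ of them can be strictly convex. (2) If all coefficients of $p$ are real, the number of unbounded components in $\mathcal{I}(p)^{\mathsf c}$ can be any integer $0\le k\le4$ except for $k=1$, and up to $2$ of them can be strictly convex.
   Context: A complex conic is a polynomial $p=az_1^2+bz_1z_2+cz_2^2+dz_1+ez_2+f$ with $a,\dots,f\in\mathbb{C}$ of total degree exactly two. The imaginary projection is $\mathcal{I}(p)=\{(\operatorname{Im} z_1,\operatorname{Im} z_2) : p(z_1,z_2)=0,\ (z_1,z_2)\in\mathbb{C}^2\}\subseteq\mathbb{R}^2$; $\mathcal{I}(p)^{\mathsf c}$ is its complement in $\mathbb{R}^2$; components are connected components. "The number can be any integer in a given set" means that the numbers which occur, as $p$ ranges over all complex conics (resp. all conics with real coefficients), are exactly those in the set; "up to $m$ of them can be strictly convex" means that $m$ is the maximal number of strictly convex unbounded components that occurs. *)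

theory Defs
  imports "HOL-Analysis.Analysis" "HOL-Computational_Algebra.Polynomial"
begin

text \<open>A bivariate polynomial in \<open>z\<^sub>1, z\<^sub>2\<close> is a polynomial in \<open>z\<^sub>2\<close> whose coefficients are
  polynomials in \<open>z\<^sub>1\<close>.\<close>

definition coeff2 :: "'a::zero poly poly \<Rightarrow> nat \<Rightarrow> nat \<Rightarrow> 'a" where
  "coeff2 p i j = coeff (coeff p j) i"

definition eval2 :: "'a::comm_semiring_0 poly poly \<Rightarrow> 'a \<Rightarrow> 'a \<Rightarrow> 'a" where
  "eval2 p z1 z2 = poly (poly p [:z2:]) z1"

text \<open>The index set below is finite; the zero polynomial gets total degree \<open>0\<close>.\<close>

definition total_degree :: "'a::zero poly poly \<Rightarrow> nat" where
  "total_degree p = Max (insert 0 {i + j | i j. coeff2 p i j \<noteq> 0})"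

definition complex_conic :: "complex poly poly \<Rightarrow> bool" where
  "complex_conic p \<longleftrightarrow> total_degree p = 2"

definition real_conic :: "complex poly poly \<Rightarrow> bool" where
  "real_conic p \<longleftrightarrow> complex_conic p \<and> (\<forall>i j. coeff2 p i j \<in> \<real>)"

definition imag_proj :: "complex poly poly \<Rightarrow> (real \<times> real) set" where
  "imag_proj p = {(Im z1, Im z2) | z1 z2. eval2 p z1 z2 = 0}"

definition unbounded_components :: "complex poly poly \<Rightarrow> (real \<times> real) set set" where
  "unbounded_components p = {C \<in> components (- imag_proj p). \<not> bounded C}"

text \<open>Strict convexity is a condition on the boundary: the complement components of an imaginary
  projection may be open, and requiring only that open segments between points of the set lie in
  its interior would hold for every open convex set.\<close>

definition strictly_convex :: "'a::real_normed_vector set \<Rightarrow> bool" where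
  "strictly_convex C \<longleftrightarrow> convex C \<and>
     (\<forall>x y. x \<noteq> y \<longrightarrow> \<not> closed_segment x y \<subseteq> frontier C)"

definition strictly_convex_unbounded_components ::
    "complex poly poly \<Rightarrow> (real \<times> real) set set" where
  "strictly_convex_unbounded_components p = {C \<in> unbounded_components p. strictly_convex C}"

lemma finite_total_degree_support:
  fixes p :: "'a::zero poly poly"
  shows "finite {i + j | i j. coeff2 p i j \<noteq> 0}"
proof -
  have "{i + j | i j. coeff2 p i j \<noteq> 0}
      \<subseteq> (\<Union>j\<le>degree p. (\<lambda>i. i + j) ` {..degree (coeff p j)})"
  proof clarify
    fix i j assume nz: "coeff2 p i j \<noteq> 0"
    then have "coeff p j \<noteq> 0" by (auto simp: coeff2_def)
    then have "j \<le> degree p" by (rule le_degree)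
    moreover have "i \<le> degree (coeff p j)"
      using nz by (auto simp: coeff2_def intro: le_degree)
    ultimately show "i + j \<in> (\<Union>j\<le>degree p. (\<lambda>i. i + j) ` {..degree (coeff p j)})"
      by blast
  qed
  then show ?thesis by (rule finite_subset) auto
qed

lemma complex_conic_iff:
  "complex_conic p \<longleftrightarrow> (\<exists>a b c d e f. p = [:[:f, d, a:], [:e, b:], [:c:]:] \<and> (a \<noteq> 0 \<or> b \<noteq> 0 \<or> c \<noteq> 0))"
proof -
  let ?S = "{i + j | i j. coeff2 p i j \<noteq> 0}"
  have fin: "finite (insert 0 ?S)" using finite_total_degree_support[of p] by simp
  have c1: "complex_conic p \<longleftrightarrow> (\<forall>i j. coeff2 p i j \<noteq> 0 \<longrightarrow> i + j \<le> 2) \<and> (\<exists>i j. coeff2 p i j \<noteq> 0 \<and> i + j = 2)"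
    (is "_ \<longleftrightarrow> ?R")
  proof -
    have "complex_conic p \<longleftrightarrow> 2 \<in> insert 0 ?S \<and> (\<forall>n\<in>insert 0 ?S. n \<le> 2)"
      unfolding complex_conic_def total_degree_def using Max_eq_iff[OF fin] by simp
    also have "\<dots> \<longleftrightarrow> ?R" by (auto; metis)
    finally show ?thesis .
  qed
  show ?thesis
  proof
    assume "complex_conic p"
    with c1 have le: "\<And>i j. i + j > 2 \<Longrightarrow> coeff (coeff p j) i = 0"
      and ex: "\<exists>i j. coeff (coeff p j) i \<noteq> 0 \<and> i + j = 2"
      by (auto simp: coeff2_def not_le[symmetric])
    let ?c = "\<lambda>i j. coeff (coeff p j) i"
    have "p = [:[:?c 0 0, ?c 1 0, ?c 2 0:], [:?c 0 1, ?c 1 1:], [:?c 0 2:]:]"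
      by (intro poly_eqI) (auto simp: coeff_pCons le numeral_2_eq_2 split: nat.splits)
    moreover have "?c 2 0 \<noteq> 0 \<or> ?c 1 1 \<noteq> 0 \<or> ?c 0 2 \<noteq> 0"
    proof -
      from ex obtain i j where ij: "?c i j \<noteq> 0" "i + j = 2" by blast
      then have "(i = 2 \<and> j = 0) \<or> (i = 1 \<and> j = 1) \<or> (i = 0 \<and> j = 2)" by arith
      with ij show ?thesis by auto
    qed
    ultimately show "\<exists>a b c d e f. p = [:[:f, d, a:], [:e, b:], [:c:]:] \<and> (a \<noteq> 0 \<or> b \<noteq> 0 \<or> c \<noteq> 0)"
      by blast
  next
    assume "\<exists>a b c d e f. p = [:[:f, d, a:], [:e, b:], [:c:]:] \<and> (a \<noteq> 0 \<or> b \<noteq> 0 \<or> c \<noteq> 0)"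
    then obtain a b c d e f where p: "p = [:[:f, d, a:], [:e, b:], [:c:]:]"
      and nz: "a \<noteq> 0 \<or> b \<noteq> 0 \<or> c \<noteq> 0" by blast
    have "\<forall>i j. coeff2 p i j \<noteq> 0 \<longrightarrow> i + j \<le> 2"
      by (auto simp: p coeff2_def coeff_pCons split: nat.splits)
    moreover have "coeff2 p 2 0 = a" "coeff2 p 1 1 = b" "coeff2 p 0 2 = c"
      by (simp_all add: p coeff2_def numeral_2_eq_2)
    then have "\<exists>i j. coeff2 p i j \<noteq> 0 \<and> i + j = 2"
      using nz by (metis add_0 add_0_right one_add_one)
    ultimately show "complex_conic p" using c1 by blast
  qed
qed

lemma eval2_conic:
  fixes z1 z2 :: "'a::comm_ring_1"
  shows "eval2 [:[:f, d, a:], [:e, b:], [:c:]:] z1 z2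
    = a * z1\<^sup>2 + b * z1 * z2 + c * z2\<^sup>2 + d * z1 + e * z2 + f"
  by (simp add: eval2_def algebra_simps power2_eq_square)

end

theory Submission
  imports Defs
begin

text \<open>A real affine change of the variables, followed by a complex translation, transforms the
  imaginary projection by an affine bijection of the plane, which preserves both counts. It brings
  a conic into one of five shapes, according to the two linear factors of the leading form.
  If both factors are real and independent, the conic becomes \<open>z\<^sub>1 z\<^sub>2 = w\<close>; the complement then
  consists of four unbounded regions, of which four, two or none are strictly convex for \<open>w\<close>
  nonreal, nonzero real, or zero, and possibly the origin. A real double factor leads to
  \<open>z\<^sub>1\<^sup>2 = w\<close> (two or three parallel half-planes and strips) or to \<open>z\<^sub>2 = g z\<^sub>1\<^sup>2\<close> (two rays for
  real \<open>g\<close>, one parabolic region otherwise).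
  If one factor is nonreal, it serves as a free complex coordinate \<open>u\<close> on the real points over a
  fixed imaginary part. For independent factors Brouwer's theorem solves the equation whenever the
  imaginary part is large, so the complement is bounded; for a nonreal double factor the equation
  \<open>u\<^sup>2 + e Im u = M\<close> is always solvable, so the complement is empty.\<close>

subsection \<open>Components under affine bijections\<close>

text \<open>Only real linear changes of variables are available: a real matrix acts on imaginary
  parts by itself, whereas a complex one mixes them with real parts. Translations may be complex,
  and so may a scalar multiplying the equation, since it leaves the zero set alone. A factor of the
  leading form can therefore be straightened to a coordinate exactly when it is real up to a complex
  scalar, and this separates the shapes. Over a fixed imaginary part, membership in the projection
  is a pair of real equations in two real unknowns. For real lines and parabolas these have
  elementary solvability conditions, which give explicit regions. A nonreal factor maps the plane of
  unknowns bijectively onto the complex numbers, but the resulting equation in \<open>u\<close>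
  involves \<open>Re u\<close> and \<open>Im u\<close> separately; it is not polynomial in
  \<open>u\<close>, whence the topological existence arguments. The complement need not be open:
  closed quadrants without their vertex, rays and an isolated origin all occur. Components are
  therefore recognised by openness relative to the complement.\<close>

definition unbounded_parts :: "'a::real_normed_vector set \<Rightarrow> 'a set set" where
  "unbounded_parts S = {C \<in> components S. \<not> bounded C}"

definition strict_parts :: "'a::real_normed_vector set \<Rightarrow> 'a set set" where
  "strict_parts S = {C \<in> unbounded_parts S. strictly_convex C}"

text \<open>A predicate in place of a polynomial turns a change of variables into plain
  substitution.\<close>

definition im_locus :: "(complex \<Rightarrow> complex \<Rightarrow> bool) \<Rightarrow> (real \<times> real) set" where
  "im_locus Q = {(Im z1, Im z2) | z1 z2. Q z1 z2}"

definition aff :: "real \<Rightarrow> real \<Rightarrow> real \<Rightarrow> real \<Rightarrow> real \<Rightarrow> real \<Rightarrow> real \<times> real \<Rightarrow> real \<times> real" where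
  "aff a1 b1 k1 a2 b2 k2 = (\<lambda>(x, y). (a1 * x + b1 * y + k1, a2 * x + b2 * y + k2))"

text \<open>The preimage direction fits substitution: if \<open>P\<close> is \<open>Q\<close>
  composed with a map, the locus of \<open>P\<close> is the preimage of the locus of
  \<open>Q\<close>.\<close>

definition aff_eq :: "(real \<times> real) set \<Rightarrow> (real \<times> real) set \<Rightarrow> bool" where
  "aff_eq S T \<longleftrightarrow> (\<exists>a1 b1 k1 a2 b2 k2. a1 * b2 - b1 * a2 \<noteq> 0 \<and> S = aff a1 b1 k1 a2 b2 k2 -` T)"

text \<open>The rest of \<open>S\<close> is the union of the other pieces, hence also relatively
  open. Each piece is thus clopen in \<open>S\<close>, and a connected subset of \<open>S\<close>
  that meets it stays inside it.\<close>

lemma components_eqI: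
  assumes disj: "pairwise disjnt A" and Un: "\<Union>A = S"
    and A: "\<And>X. X \<in> A \<Longrightarrow> connected X \<and> X \<noteq> {} \<and> openin (top_of_set S) X"
  shows "components S = A"
proof -
  have *: "connected_component_set S x = X" if X: "X \<in> A" "x \<in> X" for x X
  proof (rule connected_component_unique)
    fix c assume c: "x \<in> c" "c \<subseteq> S" "connected c"
    have "openin (top_of_set S) (\<Union>(A - {X}))" using A by blast
    moreover have "\<Union>(A - {X}) = S - X"
      using disj X(1) unfolding Un[symmetric] pairwise_def disjnt_def by blast
    ultimately have "openin (top_of_set S) (S - X)" by simp
    then obtain V where V: "open V" "S - X = S \<inter> V" unfolding openin_open by blast
    obtain T where T: "open T" "X = S \<inter> T" using A X(1) unfolding openin_open by blast
    have "x \<in> T" using X(2) unfolding T(2) by blast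
    have cX: "y \<in> X \<longleftrightarrow> y \<in> T" "y \<notin> X \<longleftrightarrow> y \<in> V" if "y \<in> c" for y
      using T(2) V(2) that c(2) by (auto simp: set_eq_iff)
    then have "T \<inter> V \<inter> c = {}" "c \<subseteq> T \<union> V" by auto
    then have "T \<inter> c = {} \<or> V \<inter> c = {}"
      using connectedD[OF c(3) T(1) V(1)] by simp
    then have "V \<inter> c = {}" using c(1) \<open>x \<in> T\<close> by blast
    then show "c \<subseteq> X" using cX by blast
  next
    show "x \<in> X" "connected X" using A X by simp_all
    show "X \<subseteq> S" using X(1) Un by blast
  qed
  show ?thesis
  proof
    show "components S \<subseteq> A"
    proof
      fix Y assume "Y \<in> components S"
      then obtain x where x: "x \<in> S" "Y = connected_component_set S x" by (auto simp: components_def)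
      then obtain X where "X \<in> A" "x \<in> X" using Un by blast
      then show "Y \<in> A" using * x by simp
    qed
    show "A \<subseteq> components S"
    proof
      fix X assume X: "X \<in> A"
      then obtain x where x: "x \<in> X" using A by blast
      then have "x \<in> S" using X Un by blast
      then show "X \<in> components S" unfolding components_def using *[OF X x] by blast
    qed
  qed
qed

lemma components_homeomorphic_image:
  fixes h :: "'a::topological_space \<Rightarrow> 'b::topological_space"
  assumes h: "homeomorphism UNIV UNIV h h'"
  shows "components (h ` S) = (`) h ` components S"
proof -
  have inv: "\<And>x. h' (h x) = x" "\<And>y. h (h' y) = y"
    using h by (auto simp: homeomorphism_def)
  have ch: "continuous_on X h" "continuous_on Y h'" for X Y
    using h by (auto simp: homeomorphism_def intro: continuous_on_subset)
  have conn: "connected (h ` X)" if "connected X" for X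
    using connected_continuous_image ch that by blast
  have conn': "connected (h' ` X)" if "connected X" for X
    using connected_continuous_image ch that by blast
  have "connected_component_set (h ` S) (h x) = h ` connected_component_set S x" if "x \<in> S" for x
  proof (rule connected_component_unique)
    show "h x \<in> h ` connected_component_set S x" using that by simp
    show "h ` connected_component_set S x \<subseteq> h ` S" using connected_component_subset by blast
    show "connected (h ` connected_component_set S x)" by (simp add: conn)
    fix c assume c: "h x \<in> c" "c \<subseteq> h ` S" "connected c"
    have "h' ` c \<subseteq> connected_component_set S x"
    proof (rule connected_component_maximal)
      show "x \<in> h' ` c" using imageI[OF c(1), of h'] by (simp add: inv)
      show "h' ` c \<subseteq> S" using image_mono[OF c(2), of h'] by (simp add: image_image inv)
    qed (use c conn' in blast)
    then have "h ` h' ` c \<subseteq> h ` connected_component_set S x" by (rule image_mono)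
    then show "c \<subseteq> h ` connected_component_set S x" by (simp add: image_image inv)
  qed
  then show ?thesis unfolding components_def image_image by (intro image_cong) auto
qed

lemma surj_plus_const:
  fixes A :: "'b \<Rightarrow> 'a::ab_group_add"
  assumes "surj A" shows "surj (\<lambda>x. A x + v)"
proof -
  have "\<exists>x. y = A x + v" for y
  proof -
    obtain x where "y - v = A x" using assms unfolding surj_def by blast
    then have "y = A x + v" by (simp add: algebra_simps)
    then show ?thesis by blast
  qed
  then show ?thesis unfolding surj_def by blast
qed

lemma bounded_affine_image_iff:
  fixes A :: "'a::euclidean_space \<Rightarrow> 'a"
  assumes "linear A" "inj A"
  shows "bounded ((\<lambda>x. A x + v) ` C) \<longleftrightarrow> bounded C"
proof -
  have "(\<lambda>x. A x + v) ` C = (\<lambda>x. v + x) ` A ` C" by (auto simp: image_image add.commute)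
  moreover have "bounded ((\<lambda>x. v + x) ` A ` C) \<longleftrightarrow> bounded (A ` C)"
    using bounded_translation[of "A ` C" v] bounded_translation[of "(\<lambda>x. v + x) ` A ` C" "- v"]
    by (auto simp: image_image)
  moreover have "bounded (A ` C) \<longleftrightarrow> bounded C"
  proof
    assume b: "bounded (A ` C)"
    obtain B where B: "linear B" "B \<circ> A = id"
      using linear_injective_left_inverse[OF assms] by blast
    have "B ` A ` C = C" using B by (simp add: image_comp)
    then show "bounded C" using bounded_linear_image[OF b] B(1) linear_conv_bounded_linear by metis
  next
    assume "bounded C" then show "bounded (A ` C)"
      using assms bounded_linear_image linear_conv_bounded_linear by blast
  qed
  ultimately show ?thesis by simp
qed

text \<open>An affine bijection commutes with closure and complement, hence with
  \<open>frontier\<close>, and it maps segments to segments.\<close>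

lemma strictly_convex_affine_image_iff:
  fixes A :: "'a::euclidean_space \<Rightarrow> 'a"
  assumes A: "linear A" "inj A"
  shows "strictly_convex ((\<lambda>x. A x + v) ` C) \<longleftrightarrow> strictly_convex C"
proof -
  let ?h = "\<lambda>x. A x + v"
  have im: "?h ` X = (\<lambda>x. v + x) ` A ` X" for X by (auto simp: image_image add.commute)
  have inj: "inj ?h" using A by (simp add: inj_def)
  have "surj A" using A linear_inj_imp_surj by blast
  then have surj: "surj ?h" by (rule surj_plus_const)
  have bij: "bij ?h" using inj surj by (simp add: bij_def)
  have clo: "closure (?h ` X) = ?h ` closure X" for X
    unfolding im by (simp add: closure_translation closure_injective_linear_image[OF A])
  have fr: "frontier (?h ` C) = ?h ` frontier C"
    by (simp add: frontier_closures bij_image_Compl_eq[OF bij, symmetric] clo image_Int[OF inj])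
  have seg: "closed_segment (?h x) (?h y) = ?h ` closed_segment x y" for x y
    unfolding im using closed_segment_translation[of v "A x" "A y"]
    by (simp add: closed_segment_linear_image[OF A(1)] add.commute)
  have cvx: "convex (?h ` C) \<longleftrightarrow> convex C"
    unfolding im convex_translation_eq using A by (simp add: convex_linear_image_eq)
  have "(\<forall>x y. x \<noteq> y \<longrightarrow> \<not> closed_segment x y \<subseteq> frontier (?h ` C)) \<longleftrightarrow>
        (\<forall>x y. ?h x \<noteq> ?h y \<longrightarrow> \<not> closed_segment (?h x) (?h y) \<subseteq> frontier (?h ` C))"
  proof (intro iffI allI impI)
    fix x y :: 'a assume H: "\<forall>x y. ?h x \<noteq> ?h y \<longrightarrow> \<not> closed_segment (?h x) (?h y) \<subseteq> frontier (?h ` C)"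
      and "x \<noteq> y"
    moreover obtain x' y' where "x = ?h x'" "y = ?h y'" using surj unfolding surj_def by blast
    ultimately show "\<not> closed_segment x y \<subseteq> frontier (?h ` C)" by blast
  qed blast
  also have "\<dots> \<longleftrightarrow> (\<forall>x y. x \<noteq> y \<longrightarrow> \<not> closed_segment x y \<subseteq> frontier C)"
    unfolding fr seg using inj by (simp add: inj_image_subset_iff[OF inj] inj_eq[OF A(2)])
  finally show ?thesis unfolding strictly_convex_def cvx by blast
qed

lemma parts_affine_image:
  fixes A :: "'a::euclidean_space \<Rightarrow> 'a" and v :: 'a
  assumes A: "linear A" "inj A"
  defines "h \<equiv> \<lambda>x. A x + v"
  shows "unbounded_parts (h ` S) = (`) h ` unbounded_parts S"
    and "strict_parts (h ` S) = (`) h ` strict_parts S"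
proof -
  obtain B where B: "linear B" "\<And>x. B (A x) = x" "\<And>x. A (B x) = x"
    using linear_injective_isomorphism[OF A] by metis
  have "homeomorphism UNIV UNIV h (\<lambda>y. B (y - v))"
  proof (rule homeomorphismI)
    show "continuous_on UNIV h"
      unfolding h_def using linear_continuous_on[of A UNIV] A(1) linear_conv_bounded_linear[of A]
      by (intro continuous_intros) auto
    show "continuous_on UNIV (\<lambda>y. B (y - v))"
      by (rule linear_continuous_on_compose[OF _ B(1)]) (intro continuous_intros)
  qed (simp_all add: h_def B)
  then have "components (h ` S) = (`) h ` components S"
    by (rule components_homeomorphic_image)
  then show 1: "unbounded_parts (h ` S) = (`) h ` unbounded_parts S"
    unfolding unbounded_parts_def using bounded_affine_image_iff[OF A, of v] by (auto simp: h_def)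
  then show "strict_parts (h ` S) = (`) h ` strict_parts S"
    unfolding strict_parts_def using strictly_convex_affine_image_iff[OF A, of v]
    by (auto simp: h_def)
qed

text \<open>As \<open>card\<close> is 0 on infinite sets too, equal cardinalities alone would not
  transfer emptiness; the finiteness clause closes this gap.\<close>

lemma aff_eq_parts:
  assumes "aff_eq S T"
  shows "card (unbounded_parts S) = card (unbounded_parts T)"
    and "card (strict_parts S) = card (strict_parts T)"
    and "finite (unbounded_parts S) \<longleftrightarrow> finite (unbounded_parts T)"
proof -
  obtain a1 b1 k1 a2 b2 k2 where D: "a1 * b2 - b1 * a2 \<noteq> 0" and S: "S = aff a1 b1 k1 a2 b2 k2 -` T"
    using assms unfolding aff_eq_def by blast
  define A :: "real \<times> real \<Rightarrow> real \<times> real" where "A = (\<lambda>(x, y). (a1 * x + b1 * y, a2 * x + b2 * y))"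
  define h where "h = (\<lambda>x. A x + (k1, k2))"
  have lin: "linear A"
    by (rule linearI) (auto simp: A_def algebra_simps)
  have inj: "inj A"
  proof (subst linear_injective_0[OF lin], clarify)
    fix x y assume "A (x, y) = 0"
    then have e: "a1 * x + b1 * y = 0" "a2 * x + b2 * y = 0" by (auto simp: A_def zero_prod_def)
    \<comment> \<open>Cramer's rule: the determinant times each coordinate is a combination of the
      two vanishing forms.\<close>
    have "(a1 * b2 - b1 * a2) * x = b2 * (a1 * x + b1 * y) - b1 * (a2 * x + b2 * y)"
      "(a1 * b2 - b1 * a2) * y = a1 * (a2 * x + b2 * y) - a2 * (a1 * x + b1 * y)"
      by (simp_all add: algebra_simps)
    then have "(a1 * b2 - b1 * a2) * x = 0" "(a1 * b2 - b1 * a2) * y = 0" by (simp_all only: e mult_zero_right diff_self)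
    then have "x = 0" "y = 0" using D by (metis mult_eq_0_iff)+
    then show "(x, y) = 0" by (simp add: zero_prod_def)
  qed
  have "surj A" using lin inj linear_inj_imp_surj by blast
  then have "surj h" unfolding h_def by (rule surj_plus_const)
  moreover have "aff a1 b1 k1 a2 b2 k2 = h" by (auto simp: aff_def h_def A_def)
  ultimately have T: "T = h ` S" using S by (simp add: surj_image_vimage_eq)
  have ih: "inj_on ((`) h) X" for X
  proof (rule inj_on_image)
    show "inj_on h (\<Union>X)" unfolding h_def by (rule inj_onI) (simp add: inj_eq[OF inj])
  qed
  note p = parts_affine_image[OF lin inj, of "(k1,k2)" S, folded h_def, folded T]
  show "card (unbounded_parts S) = card (unbounded_parts T)"
    and "card (strict_parts S) = card (strict_parts T)"
    and "finite (unbounded_parts S) \<longleftrightarrow> finite (unbounded_parts T)"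
    unfolding p by (simp_all only: card_image[OF ih] finite_image_iff[OF ih])
qed

text \<open>Taking imaginary parts commutes with the real matrix, and a complex shift contributes
  only its own imaginary part.\<close>

lemma im_locus_affine:
  fixes a1 b1 a2 b2 :: real
  assumes D: "a1 * b2 - b1 * a2 \<noteq> 0"
  assumes P: "\<And>z1 z2. P z1 z2 \<longleftrightarrow> Q (of_real a1 * z1 + of_real b1 * z2 + k1) (of_real a2 * z1 + of_real b2 * z2 + k2)"
  shows "aff_eq (- im_locus P) (- im_locus Q)"
proof -
  let ?g = "aff a1 b1 (Im k1) a2 b2 (Im k2)"
  have "im_locus P = ?g -` im_locus Q"
  proof
    show "im_locus P \<subseteq> ?g -` im_locus Q"
    proof
      fix y assume "y \<in> im_locus P"
      then obtain z1 z2 where z: "P z1 z2" "y = (Im z1, Im z2)" by (auto simp: im_locus_def)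
      define u where "u = of_real a1 * z1 + of_real b1 * z2 + k1"
      define v where "v = of_real a2 * z1 + of_real b2 * z2 + k2"
      have "Q u v" unfolding u_def v_def using z(1) by (rule P[THEN iffD1])
      moreover have "?g y = (Im u, Im v)" by (simp add: u_def v_def z aff_def)
      ultimately show "y \<in> ?g -` im_locus Q" by (auto simp: im_locus_def)
    qed
    show "?g -` im_locus Q \<subseteq> im_locus P"
    proof
      fix p assume p: "p \<in> ?g -` im_locus Q"
      obtain x y where xy: "p = (x, y)" by fastforce
      with p obtain u v where q: "Q u v" "Im u = a1 * x + b1 * y + Im k1" "Im v = a2 * x + b2 * y + Im k2"
        by (auto simp: im_locus_def aff_def)
      define d where "d = a1 * b2 - b1 * a2"
      \<comment> \<open>The inverse matrix applied to \<open>(u - k1, v - k2)\<close>. Its entries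
        are real, so the imaginary parts of the solution are \<open>x\<close> and \<open>y\<close>
        again.\<close>
      define z1 where "z1 = of_real (b2/d) * (u - k1) - of_real (b1/d) * (v - k2)"
      define z2 where "z2 = of_real (a1/d) * (v - k2) - of_real (a2/d) * (u - k1)"
      have d: "d \<noteq> 0" using D d_def by simp
      have dd: "a1 * b2 / d - b1 * a2 / d = 1" using d by (simp add: d_def flip: diff_divide_distrib)
      have "of_real a1 * z1 + of_real b1 * z2 + k1 = of_real (a1 * b2 / d - b1 * a2 / d) * (u - k1) + k1"
        "of_real a2 * z1 + of_real b2 * z2 + k2 = of_real (a1 * b2 / d - b1 * a2 / d) * (v - k2) + k2"
        by (simp_all add: z1_def z2_def algebra_simps)
      then have "P z1 z2" unfolding P using q(1) dd by simp
      moreover have "Im z1 = (a1 * b2 / d - b1 * a2 / d) * x" "Im z2 = (a1 * b2 / d - b1 * a2 / d) * y"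
        by (simp_all add: z1_def z2_def q algebra_simps add_divide_distrib)
      ultimately show "p \<in> im_locus P" using dd xy by (auto simp: im_locus_def)
    qed
  qed
  then have "- im_locus P = ?g -` (- im_locus Q)" by auto
  then show ?thesis unfolding aff_eq_def using D by blast
qed

subsection \<open>Regions bounded by hyperbolas\<close>

lemma not_bounded_ray:
  fixes C :: "'a::real_normed_vector set"
  assumes "v \<noteq> 0" and ray: "\<And>t. t0 \<le> t \<Longrightarrow> a + t *\<^sub>R v \<in> C"
  shows "\<not> bounded C"
proof
  assume "bounded C"
  then obtain B where B: "\<And>x. x \<in> C \<Longrightarrow> norm x \<le> B" unfolding bounded_iff by blast
  define t where "t = max (max t0 0) ((B + norm a + 1) / norm v)"
  have "t0 \<le> t" "0 \<le> t" by (auto simp: t_def)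
  have "(B + norm a + 1) / norm v * norm v \<le> t * norm v"
    by (intro mult_right_mono) (auto simp: t_def)
  then have "B + norm a + 1 \<le> t * norm v" using assms(1) by simp
  moreover have "norm (t *\<^sub>R v) \<le> norm (a + t *\<^sub>R v) + norm a"
    using norm_triangle_ineq4[of "a + t *\<^sub>R v" a] by simp
  moreover have "norm (t *\<^sub>R v) = t * norm v" using \<open>0 \<le> t\<close> by simp
  moreover have "norm (a + t *\<^sub>R v) \<le> B" using B ray \<open>t0 \<le> t\<close> by blast
  ultimately show False by linarith
qed

lemma not_strictly_convexI:
  assumes "x \<noteq> y" and "\<And>p e. p \<in> closed_segment x y \<Longrightarrow> 0 < e \<Longrightarrow>
    (\<exists>q\<in>C. dist p q < e) \<and> (\<exists>q. q \<notin> C \<and> dist p q < e)"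
  shows "\<not> strictly_convex C"
proof -
  have "closed_segment x y \<subseteq> frontier C"
    using assms(2) by (auto simp: frontier_straddle)
  then show ?thesis using assms(1) unfolding strictly_convex_def by blast
qed

text \<open>\<open>A'\<close> collects bounded components. It is nonempty only for nonreal
  \<open>w\<close> in the hyperbola case, where the origin is isolated in the complement.\<close>

lemma unbounded_parts_eqI:
  assumes "pairwise disjnt (A \<union> A')" "\<Union>(A \<union> A') = S"
    and "\<And>X. X \<in> A \<union> A' \<Longrightarrow> connected X \<and> X \<noteq> {} \<and> openin (top_of_set S) X"
    and "\<And>X. X \<in> A \<Longrightarrow> \<not> bounded X" "\<And>X. X \<in> A' \<Longrightarrow> bounded X"
  shows "unbounded_parts S = A"
proof -
  have "components S = A \<union> A'" by (rule components_eqI) (use assms(1-3) in auto)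
  then show ?thesis unfolding unbounded_parts_def using assms(4,5) by auto
qed

text \<open>The signs \<open>s\<close> and \<open>t\<close> select the quadrant; both are \<open>1\<close> or \<open>-1\<close> below.\<close>

definition quad :: "real \<Rightarrow> real \<Rightarrow> real \<Rightarrow> (real \<times> real) set" where
  "quad s t B = {p. 0 < s * fst p \<and> 0 < t * snd p \<and> B < (s * fst p) * (t * snd p)}"

text \<open>For \<open>w = 1\<close> the open half-axes belong to the complement, while the origin
  is the image of real solutions; this is the resulting shape of two components.\<close>

definition cquad :: "real \<Rightarrow> real \<Rightarrow> (real \<times> real) set" where
  "cquad s t = {p. 0 \<le> s * fst p \<and> 0 \<le> t * snd p \<and> p \<noteq> 0}"

lemma open_quad: "open (quad s t B)"
  unfolding quad_def by (intro open_Collect_conj open_Collect_less continuous_intros)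

text \<open>Expanding the product at the convex combination leaves a cross term
  \<open>x1 * y2 + x2 * y1\<close>, which is at least \<open>2 * B\<close> by the inequality of
  arithmetic and geometric means.\<close>

lemma hyperbola_region_convex:
  fixes B :: real
  assumes pos: "0 < x1" "0 < y1" "0 < x2" "0 < y2" and B: "0 \<le> B" "B < x1 * y1" "B < x2 * y2"
    and uv: "0 \<le> u" "0 \<le> v" "u + v = 1"
  shows "0 < u * x1 + v * x2" "0 < u * y1 + v * y2" "B < (u * x1 + v * x2) * (u * y1 + v * y2)"
proof -
  have p: "0 < u \<or> 0 < v" using uv by linarith
  have "0 < u * a + v * b" if "0 < a" "0 < b" for a b
  proof (cases "u = 0")
    case False
    then have "0 < u * a" "0 \<le> v * b" using that uv by simp_all
    then show ?thesis by (rule add_pos_nonneg)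
  qed (use that uv in simp)
  then show "0 < u * x1 + v * x2" "0 < u * y1 + v * y2" using pos by blast+
  \<comment> \<open>The mean inequality without roots: a squared sum is the squared difference plus
    four times the product.\<close>
  have "(2 * B)\<^sup>2 \<le> (x1 * y2 + x2 * y1)\<^sup>2"
  proof -
    have "B * B \<le> (x1 * y1) * (x2 * y2)" by (rule mult_mono) (use B in linarith)+
    moreover have "(x1 * y2 + x2 * y1)\<^sup>2 = (x1 * y2 - x2 * y1)\<^sup>2 + 4 * ((x1 * y1) * (x2 * y2))"
      by (simp add: power2_eq_square algebra_simps)
    moreover have "(2 * B)\<^sup>2 = 4 * (B * B)" by (simp add: power2_eq_square)
    ultimately show ?thesis using zero_le_power2[of "x1 * y2 - x2 * y1"] by linarith
  qed
  then have m: "2 * B \<le> x1 * y2 + x2 * y1"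
    by (rule power2_le_imp_le) (simp add: pos less_imp_le)
  \<comment> \<open>Splitting \<open>B\<close> along the square of \<open>u + v = 1\<close> allows a
    comparison term by term with the expanded product. Strictness comes from whichever of
    \<open>u\<close>, \<open>v\<close> is positive.\<close>
  have "B = B * (u + v)\<^sup>2" using uv by simp
  also have "\<dots> = u\<^sup>2 * B + v\<^sup>2 * B + u * v * (2 * B)"
    by (simp add: power2_eq_square algebra_simps)
  also have "\<dots> < u\<^sup>2 * (x1 * y1) + v\<^sup>2 * (x2 * y2) + u * v * (x1 * y2 + x2 * y1)"
  proof -
    have "u\<^sup>2 * B \<le> u\<^sup>2 * (x1 * y1)" "v\<^sup>2 * B \<le> v\<^sup>2 * (x2 * y2)"
      using B by (intro mult_left_mono; simp)+
    moreover have "u * v * (2 * B) \<le> u * v * (x1 * y2 + x2 * y1)"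
      by (rule mult_left_mono[OF m]) (simp add: uv)
    moreover have "u\<^sup>2 * B < u\<^sup>2 * (x1 * y1) \<or> v\<^sup>2 * B < v\<^sup>2 * (x2 * y2)"
      using p mult_strict_left_mono[OF B(2), of "u\<^sup>2"] mult_strict_left_mono[OF B(3), of "v\<^sup>2"]
        zero_less_power[of u 2] zero_less_power[of v 2] by blast
    ultimately show ?thesis by linarith
  qed
  also have "\<dots> = (u * x1 + v * x2) * (u * y1 + v * y2)"
    by (simp add: power2_eq_square algebra_simps)
  finally show "B < (u * x1 + v * x2) * (u * y1 + v * y2)" .
qed

lemma convex_quad:
  assumes "0 \<le> B" shows "convex (quad s t B)"
proof (rule convexI)
  fix p q u v assume "p \<in> quad s t B" "q \<in> quad s t B" "(0::real) \<le> u" "0 \<le> v" "u + v = 1"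
  then show "u *\<^sub>R p + v *\<^sub>R q \<in> quad s t B"
    using hyperbola_region_convex[of "s * fst p" "t * snd p" "s * fst q" "t * snd q" B u v] assms
    unfolding quad_def by (simp add: algebra_simps)
qed

text \<open>The diagonal ray lies in the region from parameter \<open>B + 1\<close> on, because then
  \<open>x * x \<ge> x > B\<close>. The superset \<open>C\<close> makes the argument serve
  \<open>cquad\<close> as well.\<close>

lemma not_bounded_superset_quad:
  assumes "quad s t B \<subseteq> C" "s\<^sup>2 = 1" "t\<^sup>2 = 1" "0 \<le> B"
  shows "\<not> bounded C"
proof (rule not_bounded_ray)
  show "(s, t) \<noteq> 0" using assms by (auto simp: zero_prod_def)
  fix x :: real assume x: "B + 1 \<le> x"
  have "x * 1 \<le> x * x" using x assms(4) by (intro mult_left_mono) auto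
  then have "0 < x" "B < x * x" using x assms(4) by linarith+
  moreover have *: "a * (x * a) = x" if "a\<^sup>2 = 1" for a
    using arg_cong[OF that, of "\<lambda>y. x * y"] by (simp add: power2_eq_square)
  ultimately have "(x * s, x * t) \<in> quad s t B"
    unfolding quad_def mem_Collect_eq fst_conv snd_conv *[OF assms(2)] *[OF assms(3)] by blast
  then have "0 + x *\<^sub>R (s, t) \<in> quad s t B" by simp
  then show "0 + x *\<^sub>R (s, t) \<in> C" using assms by blast
qed

text \<open>The frontier lies on one branch of a hyperbola. If a segment lay in it, both ends and
  the midpoint would have coordinate product \<open>B\<close>, which is the equality case of the
  mean inequality and forces the ends to coincide.\<close>

lemma strictly_convex_quad:
  assumes B: "0 < B" and s: "s\<^sup>2 = 1" and t: "t\<^sup>2 = 1"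
  shows "strictly_convex (quad s t B)"
  unfolding strictly_convex_def
proof (intro conjI allI impI notI)
  show "convex (quad s t B)" using B by (simp add: convex_quad)
  fix p q assume ne: "p \<noteq> q" and seg: "closed_segment p q \<subseteq> frontier (quad s t B)"
  let ?F = "{p. 0 \<le> s * fst p \<and> 0 \<le> t * snd p \<and> B \<le> (s * fst p) * (t * snd p)}"
  have "closed ?F" by (intro closed_Collect_conj closed_Collect_le continuous_intros)
  then have "closure (quad s t B) \<subseteq> ?F" by (intro closure_minimal) (auto simp: quad_def)
  then have fr: "0 < s * fst r \<and> 0 < t * snd r \<and> (s * fst r) * (t * snd r) = B"
    if "r \<in> frontier (quad s t B)" for r
  proof -
    have r: "r \<in> ?F" "r \<notin> quad s t B"
      using that \<open>closure _ \<subseteq> _\<close> by (auto simp: frontier_def interior_open[OF open_quad])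
    \<comment> \<open>Positivity of \<open>B\<close> keeps the frontier off the axes.\<close>
    then have "s * fst r \<noteq> 0" "t * snd r \<noteq> 0" using B by auto
    then have "0 < s * fst r" "0 < t * snd r" using r(1) unfolding mem_Collect_eq by linarith+
    moreover from this have "\<not> B < (s * fst r) * (t * snd r)" using r(2) by (simp add: quad_def)
    ultimately show ?thesis using r(1) by simp
  qed
  define m where "m = (1/2) *\<^sub>R p + (1/2) *\<^sub>R q"
  have "m \<in> closed_segment p q" unfolding m_def closed_segment_def by (auto intro!: exI[of _ "1/2"])
  then have m: "(s * fst m) * (t * snd m) = B" using fr seg by blast
  define x1 y1 x2 y2 where d: "x1 = s * fst p" "y1 = t * snd p" "x2 = s * fst q" "y2 = t * snd q"
  have p: "0 < x1" "x1 * y1 = B" and q: "0 < x2" "x2 * y2 = B"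
    unfolding d using fr[of p] fr[of q] seg ends_in_segment[of p q] by blast+
  have "(x1 + x2) * (y1 + y2) = 4 * B"
    using m unfolding m_def d by (simp add: field_simps)
  then have "x1 * y2 + x2 * y1 = 2 * B" using p q by (simp add: algebra_simps)
  \<comment> \<open>Multiplying by \<open>x1 * x2\<close> allows both products
    \<open>x1 * y1\<close> and \<open>x2 * y2\<close> to be replaced by \<open>B\<close>, which
    leaves a multiple of a perfect square.\<close>
  then have "x1 * x2 * (x1 * y2 + x2 * y1) = x1 * x2 * (2 * B)" by simp
  then have "x1 * x1 * (x2 * y2) + x2 * x2 * (x1 * y1) = x1 * x2 * (2 * B)" by (simp add: algebra_simps)
  then have "B * (x1 - x2)\<^sup>2 = 0" unfolding p q by (simp add: power2_eq_square algebra_simps)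
  then have x: "x1 = x2" using B by simp
  then have "y1 = y2" using p q by (metis less_irrefl mult_left_cancel)
  moreover have "s \<noteq> 0" "t \<noteq> 0" using s t by auto
  ultimately show False using x ne by (simp add: d prod_eq_iff)
qed

text \<open>A half-axis bounds the quadrant: points just inside belong to \<open>C\<close>, points
  just across violate the half-plane condition. The two inclusions cover open quadrants and
  \<open>cquad\<close> alike.\<close>

lemma not_strictly_convex_quadrant:
  assumes "quad s t 0 \<subseteq> C" "\<And>p. p \<in> C \<Longrightarrow> 0 \<le> t * snd p" and s: "s\<^sup>2 = 1" and t: "t\<^sup>2 = 1"
  shows "\<not> strictly_convex C"
proof (rule not_strictly_convexI)
  have "s \<noteq> 0" using s by auto
  then show "(s, 0::real) \<noteq> (2 * s, 0)" by simp
  fix p :: "real \<times> real" and e :: real assume p: "p \<in> closed_segment (s, 0) (2 * s, 0)" and e: "0 < e"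
  obtain u where u: "0 \<le> u" "p = ((1 - u) * s + u * (2 * s), 0)"
    using p by (auto simp: closed_segment_def)
  have pu: "p = (s * (1 + u), 0)" using u by (simp add: algebra_simps)
  have ss: "s * (s * a) = a" and tt: "t * (t * a) = a" for a
    using s t unfolding mult.assoc[symmetric] power2_eq_square by simp_all
  have at: "\<bar>t\<bar> = 1" using t by (simp add: power2_eq_1_iff abs_if split: if_splits) auto
  show "(\<exists>q\<in>C. dist p q < e) \<and> (\<exists>q. q \<notin> C \<and> dist p q < e)"
  proof
    have "(s * (1 + u), t * (e/2)) \<in> quad s t 0"
      unfolding quad_def using u e by (simp add: ss tt)
    moreover have "dist p (s * (1 + u), t * (e/2)) < e"
      using e at by (simp add: pu dist_Pair_Pair dist_real_def abs_mult)
    ultimately show "\<exists>q\<in>C. dist p q < e" using assms(1) by blast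
    have "(s * (1 + u), - t * (e/2)) \<notin> C"
      using assms(2)[of "(s * (1 + u), - t * (e/2))"] e tt[of "e/2"] by auto
    moreover have "dist p (s * (1 + u), - t * (e/2)) < e"
      using e at by (simp add: pu dist_Pair_Pair dist_real_def abs_mult)
    ultimately show "\<exists>q. q \<notin> C \<and> dist p q < e" by blast
  qed
qed

lemma quad_zero: "0 \<notin> quad s t B"
  by (simp add: quad_def)

lemma quad_nonempty: "s\<^sup>2 = 1 \<Longrightarrow> t\<^sup>2 = 1 \<Longrightarrow> 0 \<le> B \<Longrightarrow> quad s t B \<noteq> {}"
  using not_bounded_superset_quad[of s t B "quad s t B"] by auto

lemma openin_of_open: "open T \<Longrightarrow> X = S \<inter> T \<Longrightarrow> openin (top_of_set S) X"
  by (auto simp: openin_open)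

subsection \<open>The normal form \<open>z\<^sub>1 z\<^sub>2 = w\<close>\<close>

definition mult_locus :: "complex \<Rightarrow> (real \<times> real) set" where
  "mult_locus w = im_locus (\<lambda>z1 z2. z1 * z2 = w)"

lemma card_eq_4I:
  assumes "A \<noteq> {}" "B \<noteq> {}" "C \<noteq> {}" "D \<noteq> {}"
    "A \<inter> B = {}" "A \<inter> C = {}" "A \<inter> D = {}" "B \<inter> C = {}" "B \<inter> D = {}" "C \<inter> D = {}"
  shows "card {A, B, C, D} = 4"
proof -
  have "A \<noteq> B" "A \<noteq> C" "A \<noteq> D" "B \<noteq> C" "B \<noteq> D" "C \<noteq> D" using assms by auto
  then show ?thesis by simp
qed

text \<open>Put \<open>x = Im z1\<close>, \<open>y = Im z2\<close> and \<open>P = x * y\<close>. The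
  terms \<open>m = Re z1 * y\<close> and \<open>n = x * Re z2\<close> have sum \<open>Im w\<close>
  and product \<open>P * (P + Re w)\<close>, so they are real only if the discriminant of the
  quadratic with roots \<open>m\<close>, \<open>n\<close> is nonnegative. This says
  \<open>\<bar>2 * P + Re w\<bar> \<le> cmod w\<close>, and \<open>- A\<close> and \<open>B\<close>
  are the ends of the resulting interval. The origin is excluded because there
  \<open>m + n = 0\<close>.\<close>

lemma mult_locus_nonreal:
  assumes "w \<notin> \<real>"
  defines "A \<equiv> (cmod w + Re w) / 2" and "B \<equiv> (cmod w - Re w) / 2"
  shows "0 < A" "0 < B"
    and "- mult_locus w = {p. B < fst p * snd p} \<union> {p. fst p * snd p < - A} \<union> {0}"
proof -
  have imw: "Im w \<noteq> 0" using assms(1) by (simp add: complex_is_Real_iff)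
  have "\<bar>Re w\<bar> < cmod w"
  proof -
    have "(Re w)\<^sup>2 < (cmod w)\<^sup>2" unfolding cmod_power2 using imw by simp
    then show ?thesis by (metis abs_norm_cancel abs_square_less_1 power2_less_imp_less power2_abs norm_ge_zero)
  qed
  then show AB: "0 < A" "0 < B" by (auto simp: A_def B_def)
  have key: "(2 * P + Re w)\<^sup>2 \<le> (cmod w)\<^sup>2 \<longleftrightarrow> - A \<le> P \<and> P \<le> B" for P
    unfolding abs_le_square_iff[symmetric] by (auto simp: A_def B_def abs_le_iff field_simps)
  have disc: "(2 * P + Re w)\<^sup>2 \<le> (cmod w)\<^sup>2 \<longleftrightarrow> 0 \<le> (Im w)\<^sup>2 - 4 * (P * (P + Re w))" for P
    unfolding cmod_power2 by (simp add: power2_eq_square algebra_simps)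
  have "p \<in> mult_locus w \<longleftrightarrow> (- A \<le> fst p * snd p \<and> fst p * snd p \<le> B) \<and> p \<noteq> 0" for p
  proof -
    obtain x y where p: "p = (x, y)" by fastforce
    show ?thesis
    proof
      assume "p \<in> mult_locus w"
      then obtain z1 z2 where z: "z1 * z2 = w" "Im z1 = x" "Im z2 = y"
        by (auto simp: mult_locus_def im_locus_def p)
      define m n where mn: "m = Re z1 * y" "n = x * Re z2"
      have re: "Re z1 * Re z2 = Re w + x * y" and im: "m + n = Im w" using z by (auto simp: mn)
      have "m * n = (x * y) * (Re z1 * Re z2)" by (simp add: mn)
      then have "m * n = (x * y) * (x * y + Re w)" unfolding re by simp
      moreover have "(m + n)\<^sup>2 - 4 * (m * n) = (m - n)\<^sup>2" by (simp add: power2_eq_square algebra_simps)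
      ultimately have "0 \<le> (Im w)\<^sup>2 - 4 * (x * y * (x * y + Re w))"
        using zero_le_power2[of "m - n"] im by metis
      moreover have "p \<noteq> 0" using im imw by (auto simp: p mn zero_prod_def)
      ultimately show "(- A \<le> fst p * snd p \<and> fst p * snd p \<le> B) \<and> p \<noteq> 0"
        using key disc p by auto
    next
      assume "(- A \<le> fst p * snd p \<and> fst p * snd p \<le> B) \<and> p \<noteq> 0"
      then have dd: "0 \<le> (Im w)\<^sup>2 - 4 * ((x * y) * (x * y + Re w))" and nz: "x \<noteq> 0 \<or> y \<noteq> 0"
        using key[of "x * y"] disc[of "x * y"] by (auto simp: p zero_prod_def)
      obtain u v where uv: "u * v - x * y = Re w" "u * y + x * v = Im w"
      proof (cases "x = 0 \<or> y = 0")
        \<comment> \<open>On an axis one real part is fixed by the imaginary part of the equation.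
          It is nonzero because \<open>Im w\<close> is, so it can be divided by to find the other
          one.\<close>
        case True
        show ?thesis
        proof (cases "x = 0")
          case True
          then have "y \<noteq> 0" using nz by simp
          show ?thesis
            by (rule that[of "Im w / y" "Re w / (Im w / y)"]) (use True \<open>y \<noteq> 0\<close> imw in auto)
        next
          case False
          then have "y = 0" using \<open>x = 0 \<or> y = 0\<close> by simp
          show ?thesis
            by (rule that[of "Re w / (Im w / x)" "Im w / x"]) (use False \<open>y = 0\<close> imw in auto)
        qed
      next
        case False
        \<comment> \<open>Off the axes the quadratic formula gives \<open>m\<close> and
          \<open>n\<close>; dividing by \<open>y\<close> and \<open>x\<close> recovers the real
          parts.\<close>
        define r where "r = sqrt ((Im w)\<^sup>2 - 4 * ((x * y) * (x * y + Re w)))"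
        have r: "r * r = (Im w)\<^sup>2 - 4 * ((x * y) * (x * y + Re w))" using dd by (simp add: r_def)
        have "(Im w + r) / 2 * ((Im w - r) / 2) = ((Im w)\<^sup>2 - r * r) / 4"
          by (simp add: power2_eq_square algebra_simps)
        also have "\<dots> = (x * y) * (x * y + Re w)" unfolding r by simp
        finally have pr: "(Im w + r) / 2 * ((Im w - r) / 2) = (x * y) * (x * y + Re w)" .
        have "(Im w + r) / 2 / y * ((Im w - r) / 2 / x) = (Im w + r) / 2 * ((Im w - r) / 2) / (x * y)"
          by simp
        also have "\<dots> = x * y + Re w" unfolding pr using False by simp
        finally have 1: "(Im w + r) / 2 / y * ((Im w - r) / 2 / x) - x * y = Re w" by simp
        show ?thesis
          by (rule that[OF 1]) (use False in \<open>simp add: field_simps\<close>)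
      qed
      have "Complex u x * Complex v y = w"
        using uv by (simp add: complex_eq_iff)
      then have "p = (Im (Complex u x), Im (Complex v y)) \<and> Complex u x * Complex v y = w"
        by (simp add: p)
      then show "p \<in> mult_locus w" unfolding mult_locus_def im_locus_def by blast
    qed
  qed
  then show "- mult_locus w = {p. B < fst p * snd p} \<union> {p. fst p * snd p < - A} \<union> {0}" by auto
qed

lemma mult_pos_split:
  assumes "0 \<le> B"
  shows "{p. B < fst p * snd p} = quad 1 1 B \<union> quad (-1) (-1) B"
    and "{p. fst p * snd p < - B} = quad 1 (-1) B \<union> quad (-1) 1 B"
proof -
  show "{p. B < fst p * snd p} = quad 1 1 B \<union> quad (-1) (-1) B"
  proof (intro set_eqI iffI)
    fix p assume "p \<in> {p. B < fst p * snd p}"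
    then have "0 < fst p * snd p" "B < fst p * snd p" using assms by auto
    then show "p \<in> quad 1 1 B \<union> quad (-1) (-1) B" by (auto simp: quad_def zero_less_mult_iff)
  qed (auto simp: quad_def)
  show "{p. fst p * snd p < - B} = quad 1 (-1) B \<union> quad (-1) 1 B"
  proof (intro set_eqI iffI)
    fix p assume "p \<in> {p. fst p * snd p < - B}"
    then have "fst p * snd p < 0" "fst p * snd p < - B" using assms by auto
    then show "p \<in> quad 1 (-1) B \<union> quad (-1) 1 B" by (auto simp: quad_def mult_less_0_iff)
  qed (auto simp: quad_def)
qed

lemma quads_disjoint:
  "quad 1 1 a \<inter> quad (-1) (-1) b = {}" "quad 1 1 a \<inter> quad 1 (-1) b = {}"
  "quad 1 1 a \<inter> quad (-1) 1 b = {}" "quad (-1) (-1) a \<inter> quad 1 (-1) b = {}"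
  "quad (-1) (-1) a \<inter> quad (-1) 1 b = {}" "quad 1 (-1) a \<inter> quad (-1) 1 b = {}"
  by (auto simp: quad_def)

lemma pairwise_disjnt_insert_singleton:
  "pairwise disjnt \<Q> \<Longrightarrow> (\<And>X. X \<in> \<Q> \<Longrightarrow> a \<notin> X) \<Longrightarrow> pairwise disjnt (\<Q> \<union> {{a}})"
  by (auto simp: pairwise_def disjnt_iff)

lemma pairwise_disjnt_quads:
  "pairwise disjnt {quad 1 1 a, quad (-1) (-1) b, quad 1 (-1) c, quad (-1) 1 d}"
proof -
  have "\<forall>p\<in>X. \<forall>q\<in>Y. sgn (fst p) \<noteq> sgn (fst q) \<or> sgn (snd p) \<noteq> sgn (snd q)"
    if "X \<noteq> Y" "X \<in> {quad 1 1 a, quad (-1) (-1) b, quad 1 (-1) c, quad (-1) 1 d}"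
      "Y \<in> {quad 1 1 a, quad (-1) (-1) b, quad 1 (-1) c, quad (-1) 1 d}" for X Y
  proof -
    have "p \<in> quad 1 1 a \<Longrightarrow> sgn (fst p) = 1 \<and> sgn (snd p) = 1"
      "p \<in> quad (-1) (-1) b \<Longrightarrow> sgn (fst p) = -1 \<and> sgn (snd p) = -1"
      "p \<in> quad 1 (-1) c \<Longrightarrow> sgn (fst p) = 1 \<and> sgn (snd p) = -1"
      "p \<in> quad (-1) 1 d \<Longrightarrow> sgn (fst p) = -1 \<and> sgn (snd p) = 1" for p
      by (auto simp: quad_def)
    note * = this
    show ?thesis using that(2,3)
      by (elim insertE emptyE; use that(1) * in force)
  qed
  then show ?thesis unfolding pairwise_def disjnt_iff by blast
qed

lemma mult_parts_nonreal:
  assumes "w \<notin> \<real>"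
  shows "card (unbounded_parts (- mult_locus w)) = 4" "card (strict_parts (- mult_locus w)) = 4"
proof -
  define A where "A = (cmod w + Re w) / 2"
  define B where "B = (cmod w - Re w) / 2"
  note m = mult_locus_nonreal[OF assms, folded A_def B_def]
  let ?S = "- mult_locus w"
  let ?Q = "{quad 1 1 B, quad (-1) (-1) B, quad 1 (-1) A, quad (-1) 1 A}"
  have S: "?S = \<Union>(?Q \<union> {{0}})"
    unfolding m(3) mult_pos_split(1)[OF less_imp_le[OF m(2)]] mult_pos_split(2)[OF less_imp_le[OF m(1)]]
    by (simp add: Un_ac)
  have q: "convex (quad s t r) \<and> open (quad s t r) \<and> \<not> bounded (quad s t r) \<and>
      strictly_convex (quad s t r) \<and> quad s t r \<noteq> {}" if "s\<^sup>2 = 1" "t\<^sup>2 = 1" "0 < r" for s t r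
    using convex_quad open_quad strictly_convex_quad quad_nonempty
        not_bounded_superset_quad[OF subset_refl] that less_imp_le[OF that(3)] by blast
  have Q: "convex X \<and> open X \<and> \<not> bounded X \<and> strictly_convex X \<and> X \<noteq> {}" if "X \<in> ?Q" for X
    using that by (elim insertE emptyE; hypsubst; intro q; simp add: m(1,2))
  \<comment> \<open>The origin is isolated: in the open set where the product lies strictly between
    \<open>- A\<close> and \<open>B\<close>, it is the only point of the complement.\<close>
  have z: "{0} = ?S \<inter> {p. fst p * snd p < B \<and> - A < fst p * snd p}"
    unfolding m(3) using m(1,2) by auto
  have U: "unbounded_parts ?S = ?Q"
  proof (rule unbounded_parts_eqI[where A' = "{{0}}"])
    show "pairwise disjnt (?Q \<union> {{0}})"
      by (rule pairwise_disjnt_insert_singleton[OF pairwise_disjnt_quads]) (use quad_zero in blast)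
    show "\<Union>(?Q \<union> {{0}}) = ?S" by (rule S[symmetric])
    fix X assume "X \<in> ?Q \<union> {{0}}"
    then consider "X \<in> ?Q" | "X = {0}" by blast
    then show "connected X \<and> X \<noteq> {} \<and> openin (top_of_set ?S) X"
    proof cases
      case 1
      then have "X \<subseteq> ?S" using S by blast
      then show ?thesis using Q[OF 1] by (simp add: convex_connected open_subset)
    next
      case 2
      have "open {p. fst p * snd p < B \<and> - A < fst p * (snd p :: real)}"
        by (intro open_Collect_conj open_Collect_less continuous_intros)
      from openin_of_open[OF this z] show ?thesis unfolding 2 by simp
    qed
  next
    fix X assume "X \<in> ?Q" then show "\<not> bounded X" using Q by blast
  next
    fix X :: "(real \<times> real) set" assume "X \<in> {{0}}" then show "bounded X" by simp
  qed
  have c: "card ?Q = 4"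
    by (rule card_eq_4I) (simp_all add: quads_disjoint quad_nonempty m(1,2) less_imp_le)
  show "card (unbounded_parts ?S) = 4" unfolding U by (rule c)
  have "strict_parts ?S = ?Q" unfolding strict_parts_def U using Q by blast
  then show "card (strict_parts ?S) = 4" using c by simp
qed

lemma mult_parts_zero:
  "card (unbounded_parts (- mult_locus 0)) = 4" "strict_parts (- mult_locus 0) = {}"
proof -
  let ?S = "- mult_locus 0"
  let ?Q = "{quad 1 1 0, quad (-1) (-1) 0, quad 1 (-1) 0, quad (-1) 1 0}"
  have "mult_locus 0 = {p. fst p * snd p = 0}"
  proof (intro set_eqI iffI)
    fix p assume "p \<in> mult_locus 0"
    then obtain z1 z2 :: complex where "z1 * z2 = 0" "p = (Im z1, Im z2)"
      unfolding mult_locus_def im_locus_def by blast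
    then show "p \<in> {p. fst p * snd p = 0}" by auto
  next
    fix p :: "real \<times> real" assume "p \<in> {p. fst p * snd p = 0}"
    then have "p = (Im (Complex 0 (fst p)), Im (Complex 0 (snd p))) \<and> Complex 0 (fst p) * Complex 0 (snd p) = 0"
      by (simp add: complex_eq_iff)
    then show "p \<in> mult_locus 0" unfolding mult_locus_def im_locus_def by blast
  qed
  note m = this
  have "?S = {p. 0 < fst p * snd p} \<union> {p. fst p * snd p < - 0}"
    unfolding m by (intro set_eqI iffI; unfold Compl_iff Un_iff mem_Collect_eq minus_zero; linarith)
  then have S: "?S = \<Union>(?Q \<union> {})"
    unfolding mult_pos_split[OF order_refl] by (simp add: Un_ac)
  have Q: "convex X \<and> open X \<and> \<not> bounded X \<and> X \<noteq> {} \<and> \<not> strictly_convex X" if "X \<in> ?Q" for X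
  proof -
    have "\<not> strictly_convex (quad s t 0)" if "s\<^sup>2 = 1" "t\<^sup>2 = 1" for s t
      by (rule not_strictly_convex_quadrant[OF subset_refl]) (use that in \<open>auto simp: quad_def\<close>)
    then have q: "convex (quad s t 0) \<and> open (quad s t 0) \<and> \<not> bounded (quad s t 0) \<and>
      quad s t 0 \<noteq> {} \<and> \<not> strictly_convex (quad s t 0)" if "s\<^sup>2 = 1" "t\<^sup>2 = 1" for s t
      using convex_quad open_quad quad_nonempty not_bounded_superset_quad[OF subset_refl] that order_refl[of "0::real"] by blast
    show ?thesis using that by (elim insertE emptyE; hypsubst; intro q; simp)
  qed
  have U: "unbounded_parts ?S = ?Q"
  proof (rule unbounded_parts_eqI[where A' = "{}"])
    show "pairwise disjnt (?Q \<union> {})"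
      using pairwise_disjnt_quads[of 0 0 0 0] by simp
    show "\<Union>(?Q \<union> {}) = ?S" by (rule S[symmetric])
    fix X assume "X \<in> ?Q \<union> {}"
    then have 1: "X \<in> ?Q" by blast
    then have "X \<subseteq> ?S" using S by blast
    then show "connected X \<and> X \<noteq> {} \<and> openin (top_of_set ?S) X"
      using Q[OF 1] by (simp add: convex_connected open_subset)
  next
    fix X assume "X \<in> ?Q" then show "\<not> bounded X" using Q by blast
  qed simp
  have c: "card ?Q = 4"
    by (rule card_eq_4I) (simp_all add: quads_disjoint quad_nonempty)
  show "card (unbounded_parts ?S) = 4" unfolding U by (rule c)
  show "strict_parts ?S = {}" unfolding strict_parts_def U using Q by blast
qed

text \<open>Vanishing of \<open>Im (z1 * z2)\<close> makes the two mixed terms opposite, so with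
  \<open>P = Im z1 * Im z2\<close> the quantity \<open>P * (1 + P)\<close> is minus a square and
  \<open>-1 \<le> P \<le> 0\<close>. If \<open>P = 0\<close>, both real parts are nonzero, and the
  mixed terms then force both imaginary parts to vanish.\<close>

lemma mult_locus_one: "mult_locus 1 = {p. - 1 \<le> fst p * snd p \<and> fst p * snd p < 0} \<union> {0}"
proof (intro set_eqI iffI)
  fix p assume "p \<in> mult_locus 1"
  then obtain z1 z2 where z: "z1 * z2 = 1" "p = (Im z1, Im z2)"
    unfolding mult_locus_def im_locus_def by blast
  define P where "P = Im z1 * Im z2"
  have re: "Re z1 * Re z2 = 1 + P" using arg_cong[OF z(1), of Re] by (simp add: P_def)
  have im: "Re z1 * Im z2 = - (Im z1 * Re z2)" using arg_cong[OF z(1), of Im] by simp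
  have "P * (1 + P) = P * (Re z1 * Re z2)" unfolding re ..
  also have "\<dots> = (Re z1 * Im z2) * (Im z1 * Re z2)" by (simp add: P_def)
  also have "\<dots> = - (Im z1 * Re z2)\<^sup>2" unfolding im by (simp add: power2_eq_square)
  finally have "P * (1 + P) \<le> 0" by simp
  then have P: "- 1 \<le> P" "P \<le> 0" by (auto simp: mult_le_0_iff)
  have "p = 0" if "P = 0"
  proof -
    from that consider "Im z1 = 0" | "Im z2 = 0" unfolding P_def by auto
    then show ?thesis
    proof cases
      case 1
      then have "Re z1 \<noteq> 0" using re that by auto
      then have "Im z2 = 0" using im 1 by simp
      then show ?thesis using 1 z by (simp add: zero_prod_def)
    next
      case 2
      then have "Re z2 \<noteq> 0" using re that by auto
      then have "Im z1 = 0" using im 2 by simp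
      then show ?thesis using 2 z by (simp add: zero_prod_def)
    qed
  qed
  moreover have "fst p * snd p = P" by (simp add: z P_def)
  ultimately show "p \<in> {p. - 1 \<le> fst p * snd p \<and> fst p * snd p < 0} \<union> {0}"
    using P by (cases "P = 0") simp_all
next
  fix p :: "real \<times> real" assume "p \<in> {p. - 1 \<le> fst p * snd p \<and> fst p * snd p < 0} \<union> {0}"
  then consider "p = 0" | "- 1 \<le> fst p * snd p" "fst p * snd p < 0" by blast
  then show "p \<in> mult_locus 1"
  proof cases
    case 1
    then have "p = (Im 1, Im 1) \<and> (1::complex) * 1 = 1" by (simp add: zero_prod_def)
    then show ?thesis unfolding mult_locus_def im_locus_def by blast
  next
    case 2
    define P where "P = fst p * snd p"
    have nz: "fst p \<noteq> 0" "snd p \<noteq> 0" using 2 by auto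
    \<comment> \<open>The mixed terms must be \<open>r\<close> and \<open>- r\<close> with product
      \<open>P * (1 + P)\<close>.\<close>
    define r where "r = sqrt (- P * (1 + P))"
    have "0 \<le> - P * (1 + P)" using 2 unfolding P_def by (intro mult_nonneg_nonneg) auto
    then have r: "r * r = - P * (1 + P)" by (simp add: r_def)
    have "(r / snd p) * (- r / fst p) = - (r * r) / P" by (simp add: P_def)
    also have "\<dots> = 1 + P" unfolding r using nz by (simp add: P_def)
    finally have "Complex (r / snd p) (fst p) * Complex (- r / fst p) (snd p) = 1"
      using nz by (simp add: complex_eq_iff P_def)
    then have "p = (Im (Complex (r / snd p) (fst p)), Im (Complex (- r / fst p) (snd p))) \<and>
      Complex (r / snd p) (fst p) * Complex (- r / fst p) (snd p) = 1" by simp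
    then show ?thesis unfolding mult_locus_def im_locus_def by blast
  qed
qed

text \<open>Inside a closed quadrant, being nonzero is the same as the coordinate sum having the
  sign of the quadrant. This linear form yields both convexity and relative openness.\<close>

lemma mem_cquad:
  "p \<in> cquad 1 1 \<longleftrightarrow> 0 \<le> fst p \<and> 0 \<le> snd p \<and> 0 < fst p + snd p"
  "p \<in> cquad (-1) (-1) \<longleftrightarrow> fst p \<le> 0 \<and> snd p \<le> 0 \<and> fst p + snd p < 0"
  unfolding cquad_def mem_Collect_eq prod_eq_iff fst_zero snd_zero by linarith+

lemma convex_cquad: "convex (cquad 1 1)" "convex (cquad (-1) (-1))"
proof -
  have 1: "cquad 1 1 = {p. 0 \<le> (1, 0) \<bullet> p} \<inter> ({p. 0 \<le> (0, 1) \<bullet> p} \<inter> {p. 0 < (1, 1) \<bullet> p})"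
    unfolding set_eq_iff Int_iff mem_Collect_eq mem_cquad inner_prod_def by simp
  show "convex (cquad 1 1)"
    unfolding 1 by (rule convex_Int convex_halfspace_ge convex_halfspace_gt)+
  have 2: "cquad (-1) (-1) = {p. (1, 0) \<bullet> p \<le> 0} \<inter> ({p. (0, 1) \<bullet> p \<le> 0} \<inter> {p. (1, 1) \<bullet> p < 0})"
    unfolding set_eq_iff Int_iff mem_Collect_eq mem_cquad inner_prod_def by simp
  show "convex (cquad (-1) (-1))"
    unfolding 2 by (rule convex_Int convex_halfspace_le convex_halfspace_lt)+
qed

lemma mult_parts_one:
  "card (unbounded_parts (- mult_locus 1)) = 4" "card (strict_parts (- mult_locus 1)) = 2"
proof -
  let ?S = "- mult_locus 1"
  let ?H = "{quad 1 (-1) 1, quad (-1) 1 1}"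
  let ?C1 = "cquad 1 1" let ?C2 = "cquad (-1) (-1)"
  let ?Q = "{?C1, ?C2, quad 1 (-1) 1, quad (-1) 1 1}"
  \<comment> \<open>Open sets that separate the two half-closed quadrants: the product condition
    removes the hyperbolic regions, and the sign of the sum distinguishes the opposite
    quadrants.\<close>
  let ?T1 = "{p::real\<times>real. 0 < fst p + snd p \<and> - 1 < fst p * snd p}"
  let ?T2 = "{p::real\<times>real. fst p + snd p < 0 \<and> - 1 < fst p * snd p}"
  note c = mem_cquad
  have pp: "p \<in> ?C1 \<or> p \<in> ?C2 \<longleftrightarrow> 0 \<le> fst p * snd p \<and> p \<noteq> 0" for p :: "real \<times> real"
    unfolding c prod_eq_iff fst_zero snd_zero zero_le_mult_iff by linarith
  have S': "p \<in> ?S \<longleftrightarrow> p \<in> ?C1 \<or> p \<in> ?C2 \<or> fst p * snd p < - 1" for p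
  proof -
    have "fst p * snd p < - 1 \<Longrightarrow> p \<noteq> 0" by auto
    then have "p \<in> ?S \<longleftrightarrow> (0 \<le> fst p * snd p \<and> p \<noteq> 0) \<or> fst p * snd p < - 1"
      unfolding mult_locus_one Compl_iff Un_iff mem_Collect_eq singleton_iff by linarith
    then show ?thesis unfolding pp[symmetric] by blast
  qed
  have hq: "fst p * snd p < - 1 \<longleftrightarrow> p \<in> quad 1 (-1) 1 \<or> p \<in> quad (-1) 1 1" for p
    using mult_pos_split(2)[of 1] by (simp add: set_eq_iff)
  have S: "\<Union>(?Q \<union> {}) = ?S" unfolding set_eq_iff S' hq by simp
  have z1: "?C1 = ?S \<inter> ?T1" and z2: "?C2 = ?S \<inter> ?T2"
  proof -
    have nn: "p \<in> ?C1 \<Longrightarrow> 0 \<le> fst p * snd p" "p \<in> ?C2 \<Longrightarrow> 0 \<le> fst p * snd p" for p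
      using pp by blast+
    show "?C1 = ?S \<inter> ?T1"
    proof (rule set_eqI)
      fix p show "p \<in> ?C1 \<longleftrightarrow> p \<in> ?S \<inter> ?T1"
        using nn[of p] c[of p] unfolding Int_iff S' mem_Collect_eq by linarith
    qed
    show "?C2 = ?S \<inter> ?T2"
    proof (rule set_eqI)
      fix p show "p \<in> ?C2 \<longleftrightarrow> p \<in> ?S \<inter> ?T2"
        using nn[of p] c[of p] unfolding Int_iff S' mem_Collect_eq by linarith
    qed
  qed
  have qs: "quad 1 1 0 \<subseteq> ?C1" "quad (-1) (-1) 0 \<subseteq> ?C2"
    unfolding c subset_iff quad_def by simp_all
  have ub: "\<not> bounded X" if "X \<in> ?Q" for X
    using that
    by (elim insertE emptyE; hypsubst; intro not_bounded_superset_quad[OF qs(1)]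
        not_bounded_superset_quad[OF qs(2)] not_bounded_superset_quad[OF subset_refl]; simp)
  have U: "unbounded_parts ?S = ?Q"
  proof (rule unbounded_parts_eqI[where A' = "{}"])
    show "pairwise disjnt (?Q \<union> {})"
    proof -
      have "?C1 \<inter> ?C2 = {}" "?C1 \<inter> quad 1 (-1) 1 = {}" "?C1 \<inter> quad (-1) 1 1 = {}"
        "?C2 \<inter> quad 1 (-1) 1 = {}" "?C2 \<inter> quad (-1) 1 1 = {}"
        unfolding disjoint_iff c quad_def by simp_all
      then show ?thesis using quads_disjoint(6)[of 1 1] unfolding pairwise_def disjnt_def by blast
    qed
    show "\<Union>(?Q \<union> {}) = ?S" by (rule S)
    fix X assume "X \<in> ?Q \<union> {}"
    then consider "X = ?C1" | "X = ?C2" | "X \<in> ?H" by blast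
    then show "connected X \<and> X \<noteq> {} \<and> openin (top_of_set ?S) X"
    proof cases
      case 1
      have "open ?T1" by (intro open_Collect_conj open_Collect_less continuous_intros)
      moreover have "X \<noteq> {}" using ub[of X] 1 by auto
      ultimately show ?thesis
        using openin_of_open[OF _ z1] convex_connected[OF convex_cquad(1)] unfolding 1 by blast
    next
      case 2
      have "open ?T2" by (intro open_Collect_conj open_Collect_less continuous_intros)
      moreover have "X \<noteq> {}" using ub[of X] 2 by auto
      ultimately show ?thesis
        using openin_of_open[OF _ z2] convex_connected[OF convex_cquad(2)] unfolding 2 by blast
    next
      case 3
      then have "X \<subseteq> ?S" using S by blast
      moreover have "X \<noteq> {}" using ub[of X] 3 by auto
      moreover have "open X" "convex X" using 3 by (auto simp: open_quad convex_quad)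
      ultimately show ?thesis by (simp add: convex_connected open_subset)
    qed
  qed (use ub in auto)
  have "?C1 \<noteq> {}" "?C2 \<noteq> {}" using ub[of ?C1] ub[of ?C2] by auto
  moreover have "?C1 \<inter> ?C2 = {}" "?C1 \<inter> quad 1 (-1) 1 = {}" "?C1 \<inter> quad (-1) 1 1 = {}"
    "?C2 \<inter> quad 1 (-1) 1 = {}" "?C2 \<inter> quad (-1) 1 1 = {}"
    unfolding disjoint_iff c quad_def by simp_all
  ultimately have "card ?Q = 4"
    by (intro card_eq_4I) (simp_all add: quads_disjoint quad_nonempty)
  then show "card (unbounded_parts ?S) = 4" unfolding U .
  have "\<not> strictly_convex ?C1" "\<not> strictly_convex ?C2"
    by (rule not_strictly_convex_quadrant[OF qs(1)] not_strictly_convex_quadrant[OF qs(2)]; simp add: c)+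
  moreover have "strictly_convex (quad 1 (-1) 1)" "strictly_convex (quad (-1) 1 1)"
    by (simp_all add: strictly_convex_quad)
  ultimately have "strict_parts ?S = ?H" unfolding strict_parts_def U by blast
  moreover have "quad 1 (-1) 1 \<noteq> quad (-1) 1 1"
    using quads_disjoint(6)[of 1 1] quad_nonempty[of 1 "-1" 1] by auto
  ultimately show "card (strict_parts ?S) = 2" by simp
qed

subsection \<open>Double lines and parabolas\<close>

definition square_locus :: "complex \<Rightarrow> (real \<times> real) set" where
  "square_locus w = im_locus (\<lambda>z1 z2. z1\<^sup>2 = w)"

definition parabola_locus :: "complex \<Rightarrow> (real \<times> real) set" where
  "parabola_locus g = im_locus (\<lambda>z1 z2. z2 = g * z1\<^sup>2)"

lemma square_parts:
  "card (unbounded_parts (- square_locus w)) = (if Im (csqrt w) = 0 then 2 else 3)"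
  "card (strict_parts (- square_locus w)) \<le> 2"
proof -
  define h where "h = \<bar>Im (csqrt w)\<bar>"
  let ?S = "- square_locus w"
  \<comment> \<open>Both roots occur with \<open>z2\<close> free, so the locus consists of the
    vertical lines at \<open>h\<close> and \<open>- h\<close>, which coincide for
    \<open>h = 0\<close>.\<close>
  have sq: "z\<^sup>2 = w \<longleftrightarrow> z = csqrt w \<or> z = - csqrt w" for z
    using power2_eq_iff[of z "csqrt w"] by simp
  have I: "p \<in> square_locus w \<longleftrightarrow> fst p = h \<or> fst p = - h" for p
  proof
    assume "p \<in> square_locus w"
    then obtain z1 z2 where z: "z1\<^sup>2 = w" "p = (Im z1, Im z2)"
      unfolding square_locus_def im_locus_def by blast
    then have "Im z1 = Im (csqrt w) \<or> Im z1 = - Im (csqrt w)" using sq by auto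
    then show "fst p = h \<or> fst p = - h" unfolding h_def z by auto
  next
    assume "fst p = h \<or> fst p = - h"
    then have "fst p = Im (csqrt w) \<or> fst p = Im (- csqrt w)" unfolding h_def by auto
    then obtain z where z: "z\<^sup>2 = w" "fst p = Im z" using sq by blast
    have "p = (Im z, Im (Complex 0 (snd p))) \<and> z\<^sup>2 = w" using z by (simp add: prod_eq_iff)
    then show "p \<in> square_locus w" unfolding square_locus_def im_locus_def by blast
  qed
  have h0: "0 \<le> h" by (simp add: h_def)
  define L where "L = {p::real\<times>real. fst p < - h}"
  define M where "M = {p::real\<times>real. - h < fst p \<and> fst p < h}"
  define R where "R = {p::real\<times>real. h < fst p}"
  note defs = L_def M_def R_def
  have op: "open L" "open M" "open R"
    unfolding defs by (intro open_Collect_conj open_Collect_less continuous_intros)+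
  have cv: "convex L" "convex M" "convex R"
  proof -
    have "L = {p. (1, 0) \<bullet> p < - h}" "R = {p. h < (1, 0) \<bullet> p}"
      "M = {p. (1, 0) \<bullet> p < h} \<inter> {p. - h < (1, 0) \<bullet> p}"
      unfolding defs by (auto simp: inner_prod_def)
    then show "convex L" "convex M" "convex R"
      using convex_halfspace_lt convex_halfspace_gt convex_Int by metis+
  qed
  have Un: "?S = L \<union> M \<union> R"
    unfolding set_eq_iff Compl_iff Un_iff I defs mem_Collect_eq using h0 by force
  have ubL: "\<not> bounded L" "\<not> bounded R"
    using not_bounded_ray[of "(0, 1)" 0 "(- h - 1, 0)" L] not_bounded_ray[of "(0, 1)" 0 "(h + 1, 0)" R]
    by (auto simp: defs zero_prod_def)
  have ubM: "\<not> bounded M" if "0 < h"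
    using not_bounded_ray[of "(0, 1)" 0 "(0, 0)" M] that by (auto simp: defs zero_prod_def)
  have ne: "L \<noteq> {}" "R \<noteq> {}" using ubL by auto
  have dj: "L \<inter> M = {}" "L \<inter> R = {}" "M \<inter> R = {}" using h0 unfolding defs disjoint_iff by auto
  have open_in: "openin (top_of_set ?S) L" "openin (top_of_set ?S) M" "openin (top_of_set ?S) R"
    using op Un by (auto intro: open_subset)
  show "card (unbounded_parts ?S) = (if Im (csqrt w) = 0 then 2 else 3)" and "card (strict_parts ?S) \<le> 2"
  proof -
    have "card (unbounded_parts ?S) = (if h = 0 then 2 else 3) \<and> card (strict_parts ?S) \<le> 2"
    proof (cases "h = 0")
      case True
      then have M: "M = {}" by (simp add: M_def)
      have U: "unbounded_parts ?S = {L, R}"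
        by (rule unbounded_parts_eqI[where A' = "{}"])
          (use Un M ne cv open_in ubL dj in \<open>auto simp: pairwise_insert disjnt_def convex_connected\<close>)
      have "L \<noteq> R" using dj ne by auto
      then have c: "card {L, R} = 2" by simp
      have "strict_parts ?S \<subseteq> {L, R}" unfolding strict_parts_def U by blast
      then show ?thesis using True U c card_mono[of "{L, R}" "strict_parts ?S"] by simp
    next
      case False
      then have h: "0 < h" using h0 by simp
      have neM: "M \<noteq> {}" using ubM[OF h] by auto
      have U: "unbounded_parts ?S = {L, M, R}"
        by (rule unbounded_parts_eqI[where A' = "{}"])
          (use Un ne neM cv open_in ubL ubM[OF h] dj in \<open>auto simp: pairwise_insert disjnt_def convex_connected\<close>)
      have d: "L \<noteq> R" "L \<noteq> M" "M \<noteq> R" using dj ne neM by auto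
      \<comment> \<open>With three components, one has to be ruled out to reach the bound 2; the
        strip has a whole line in its frontier.\<close>
      have "\<not> strictly_convex M"
      proof (rule not_strictly_convexI[of "(h, 0)" "(h, 1)"])
        fix p :: "real \<times> real" and e :: real
        assume p: "p \<in> closed_segment (h, 0) (h, 1)" and e: "0 < e"
        then have fp: "fst p = h" by (auto simp: closed_segment_def algebra_simps)
        define r where "r = min (e/2) h"
        have r: "0 < r" "r < e" "r \<le> h" using e h by (auto simp: r_def)
        have "dist p (h - r, snd p) < e"
          using r by (simp add: dist_prod_def fp dist_real_def)
        moreover have "(h - r, snd p) \<in> M" using r h by (simp add: M_def)
        moreover have "dist p p < e" "p \<notin> M" using e by (simp_all add: M_def fp)
        ultimately show "(\<exists>q\<in>M. dist p q < e) \<and> (\<exists>q. q \<notin> M \<and> dist p q < e)" by blast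
      qed simp
      then have "strict_parts ?S \<subseteq> {L, R}" unfolding strict_parts_def U by blast
      then show ?thesis using False U d card_mono[of "{L, R}" "strict_parts ?S"] by simp
    qed
    moreover have "h = 0 \<longleftrightarrow> Im (csqrt w) = 0" by (simp add: h_def)
    ultimately show "card (unbounded_parts ?S) = (if Im (csqrt w) = 0 then 2 else 3)"
      "card (strict_parts ?S) \<le> 2" by simp_all
  qed
qed

text \<open>The real part of \<open>z2\<close> can absorb the real part of the equation, so only the
  imaginary part constrains, with \<open>s = Re z1\<close> as the single unknown.\<close>

lemma mem_parabola_locus:
  "p \<in> parabola_locus g \<longleftrightarrow> (\<exists>s. snd p = Im g * (s\<^sup>2 - (fst p)\<^sup>2) + 2 * Re g * s * fst p)"
proof -
  have im: "Im (g * (Complex s t)\<^sup>2) = Im g * (s\<^sup>2 - t\<^sup>2) + 2 * Re g * s * t" for s t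
    by (simp add: power2_eq_square algebra_simps)
  show ?thesis
  proof
    assume "p \<in> parabola_locus g"
    then obtain z1 where z: "p = (Im z1, Im (g * z1\<^sup>2))"
      unfolding parabola_locus_def im_locus_def by blast
    then show "\<exists>s. snd p = Im g * (s\<^sup>2 - (fst p)\<^sup>2) + 2 * Re g * s * fst p"
      using im[of "Re z1" "Im z1"] by auto
  next
    assume "\<exists>s. snd p = Im g * (s\<^sup>2 - (fst p)\<^sup>2) + 2 * Re g * s * fst p"
    then obtain s where "snd p = Im (g * (Complex s (fst p))\<^sup>2)" unfolding im by blast
    then have "p = (Im (Complex s (fst p)), Im (g * (Complex s (fst p))\<^sup>2))"
      by (simp add: prod_eq_iff)
    then show "p \<in> parabola_locus g" unfolding parabola_locus_def im_locus_def by blast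
  qed
qed

text \<open>For real \<open>g\<close> the condition is linear in \<open>s\<close>, with slope
  \<open>2 * Re g * fst p\<close>. It is solvable off the axis \<open>fst p = 0\<close>; on that
  axis it holds only at the origin. The complement is this axis without the origin.\<close>

lemma parabola_parts_real:
  assumes "g \<in> \<real>" "g \<noteq> 0"
  shows "card (unbounded_parts (- parabola_locus g)) = 2"
proof -
  let ?S = "- parabola_locus g"
  have im: "Im g = 0" using assms(1) by (simp add: complex_is_Real_iff)
  then have re: "Re g \<noteq> 0" using assms(2) by (simp add: complex_eq_iff)
  have I: "p \<in> ?S \<longleftrightarrow> fst p = 0 \<and> snd p \<noteq> 0" for p
  proof -
    have "\<exists>s. snd p = 2 * Re g * s * fst p" if "fst p \<noteq> 0"
      by (rule exI[of _ "snd p / (2 * Re g * fst p)"]) (use re that in simp)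
    then show ?thesis unfolding Compl_iff mem_parabola_locus im by (cases "fst p = 0") auto
  qed
  define U where "U = {p::real\<times>real. fst p = 0 \<and> 0 < snd p}"
  define V where "V = {p::real\<times>real. fst p = 0 \<and> snd p < 0}"
  have cv: "convex U" "convex V"
  proof -
    have "U = {p. (1, 0) \<bullet> p = 0} \<inter> {p. 0 < (0, 1) \<bullet> p}" "V = {p. (1, 0) \<bullet> p = 0} \<inter> {p. (0, 1) \<bullet> p < 0}"
      unfolding U_def V_def by (auto simp: inner_prod_def)
    then show "convex U" "convex V"
      using convex_halfspace_lt convex_halfspace_gt convex_hyperplane convex_Int by metis+
  qed
  have ub: "\<not> bounded U" "\<not> bounded V"
    using not_bounded_ray[of "(0, 1)" 1 0 U] not_bounded_ray[of "(0, -1)" 1 0 V]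
    by (auto simp: U_def V_def zero_prod_def)
  have dj: "U \<inter> V = {}" by (auto simp: U_def V_def)
  have ne: "U \<noteq> {}" "V \<noteq> {}" using ub by auto
  have Un: "?S = U \<union> V" unfolding set_eq_iff Un_iff I U_def V_def by auto
  have "open {p::real\<times>real. 0 < snd p}" "open {p::real\<times>real. snd p < 0}"
    by (intro open_Collect_less continuous_intros)+
  moreover have "U = ?S \<inter> {p. 0 < snd p}" "V = ?S \<inter> {p. snd p < 0}"
    unfolding set_eq_iff Int_iff I U_def V_def by auto
  ultimately have oi: "openin (top_of_set ?S) U" "openin (top_of_set ?S) V"
    using openin_of_open by blast+
  have "unbounded_parts ?S = {U, V}"
    by (rule unbounded_parts_eqI[where A' = "{}"])
      (use Un ne cv oi ub dj in \<open>auto simp: pairwise_insert disjnt_def convex_connected\<close>)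
  moreover have "U \<noteq> V" using dj ne by auto
  ultimately show ?thesis by simp
qed

text \<open>Multiplying the condition by \<open>Im g\<close> and completing the square in
  \<open>s\<close> shows that it is solvable exactly when
  \<open>Im g * snd p + K * (fst p)\<^sup>2\<close> is nonnegative, with \<open>K\<close> the
  squared modulus of \<open>g\<close>. The complement is the open convex side of a parabola, for
  either sign of \<open>Im g\<close>.\<close>

lemma parabola_parts_nonreal:
  assumes "g \<notin> \<real>"
  shows "card (unbounded_parts (- parabola_locus g)) = 1"
proof -
  let ?S = "- parabola_locus g"
  have im: "Im g \<noteq> 0" using assms by (simp add: complex_is_Real_iff)
  define K where "K = (Re g)\<^sup>2 + (Im g)\<^sup>2"
  have K: "0 \<le> K" by (simp add: K_def)
  have sq: "Im g * (Im g * (s\<^sup>2 - x\<^sup>2) + 2 * Re g * s * x) = (Im g * s + Re g * x)\<^sup>2 - K * x\<^sup>2" for s x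
    by (simp add: K_def power2_eq_square algebra_simps)
  have I: "p \<in> parabola_locus g \<longleftrightarrow> 0 \<le> Im g * snd p + K * (fst p)\<^sup>2" for p
  proof
    assume "p \<in> parabola_locus g"
    then obtain s where "snd p = Im g * (s\<^sup>2 - (fst p)\<^sup>2) + 2 * Re g * s * fst p"
      unfolding mem_parabola_locus by blast
    then have "Im g * snd p + K * (fst p)\<^sup>2 = (Im g * s + Re g * fst p)\<^sup>2" using sq[of s "fst p"] by simp
    then show "0 \<le> Im g * snd p + K * (fst p)\<^sup>2" by simp
  next
    assume nn: "0 \<le> Im g * snd p + K * (fst p)\<^sup>2"
    define s where "s = (sqrt (Im g * snd p + K * (fst p)\<^sup>2) - Re g * fst p) / Im g"
    have "(Im g * s + Re g * fst p)\<^sup>2 = Im g * snd p + K * (fst p)\<^sup>2"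
      using nn im by (simp add: s_def)
    then have "Im g * snd p = Im g * (Im g * (s\<^sup>2 - (fst p)\<^sup>2) + 2 * Re g * s * fst p)"
      unfolding sq by simp
    then show "p \<in> parabola_locus g" unfolding mem_parabola_locus using im mult_left_cancel by blast
  qed
  have S: "?S = {p. Im g * snd p + K * (fst p)\<^sup>2 < 0}" unfolding set_eq_iff Compl_iff I by auto
  have "convex ?S"
  proof (rule convexI)
    fix p q :: "real \<times> real" and u v :: real
    assume a: "p \<in> ?S" "q \<in> ?S" "0 \<le> u" "0 \<le> v" "u + v = 1"
    define f where "f r = Im g * snd r + K * (fst r)\<^sup>2" for r
    have fpq: "f p < 0" "f q < 0" using a unfolding S f_def by auto
    have v: "v = 1 - u" using a by simp
    \<comment> \<open>The defect of convexity of a quadratic with leading coefficient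
      \<open>K\<close>.\<close>
    have "f (u *\<^sub>R p + v *\<^sub>R q) = u * f p + v * f q - K * (u * v * (fst p - fst q)\<^sup>2)"
      unfolding f_def v by (simp add: power2_eq_square algebra_simps)
    also have "\<dots> \<le> u * f p + v * f q" using K a by simp
    also have "\<dots> < 0"
    proof (cases "u = 0")
      case False
      then have "u * f p < 0" "v * f q \<le> 0" using a fpq by (auto simp: mult_less_0_iff mult_le_0_iff)
      then show ?thesis by linarith
    qed (use fpq v in simp)
    finally show "u *\<^sub>R p + v *\<^sub>R q \<in> ?S" unfolding S f_def by simp
  qed
  moreover have "\<not> bounded ?S"
  proof (rule not_bounded_ray)
    show "(0, - Im g) \<noteq> (0::real\<times>real)" using im by (simp add: prod_eq_iff)
    fix t :: real assume "1 \<le> t"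
    moreover have "0 < Im g * Im g" using im by (metis not_real_square_gt_zero)
    ultimately have "- (t * (Im g * Im g)) < 0" by simp
    then show "0 + t *\<^sub>R (0, - Im g) \<in> ?S" unfolding S by (simp add: mult.left_commute)
  qed
  ultimately have "unbounded_parts ?S = {?S}"
    by (intro unbounded_parts_eqI[where A' = "{}"]) (auto simp: convex_connected)
  then show ?thesis by simp
qed

subsection \<open>A nonreal linear factor\<close>

text \<open>The hypothesis says that the second factor is not a multiple of
  \<open>z1 + \<i> * z2\<close>. Encode the imaginary part as \<open>Y\<close> and use
  \<open>u = z1 + \<i> * z2\<close> as unknown: then \<open>z1 = Re u + \<i> * Y\<close> and
  \<open>z2 = Im u - Y\<close>, and the equation becomes \<open>D * Y * (u - a) = N u\<close> with
  \<open>N\<close> independent of \<open>Y\<close>. For large \<open>Y\<close> the map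
  \<open>a + N u / (D * Y)\<close> sends the unit ball around \<open>a\<close> into itself, and a
  fixed point is a solution.\<close>

lemma nonreal_factor_bounded:
  assumes D: "\<i> * g - d \<noteq> 0"
  shows "bounded (- im_locus (\<lambda>z1 z2. (z1 + \<i> * z2) * (g * z1 + d * z2) + p * z1 + q * z2 + f = 0))"
proof -
  define D where "D = \<i> * g - d"
  \<comment> \<open>The centre cancels the terms of the equation that are linear in
    \<open>Y\<close>; it does not depend on the imaginary part, so one bound \<open>K\<close> on one
    ball suffices.\<close>
  define a where "a = - (\<i> * p - q) / D"
  define L where "L u = g * of_real (Re u) + d * of_real (Im u)" for u
  define P where "P u = p * of_real (Re u) + q * of_real (Im u)" for u
  define N where "N u = - (u * L u + P u + f)" for u
  have Dnz: "D \<noteq> 0" using D D_def by simp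
  have cN: "continuous_on (cball a 1) N"
    unfolding N_def L_def P_def by (intro continuous_intros)
  then have "compact (N ` cball a 1)" by (intro compact_continuous_image) auto
  then have "bounded (N ` cball a 1)" by (rule compact_imp_bounded)
  then obtain K where "\<forall>x\<in>N ` cball a 1. cmod x \<le> K" unfolding bounded_iff ..
  then have K: "cmod (N u) \<le> K" if "u \<in> cball a 1" for u using that by simp
  have K0: "0 \<le> K" using order_trans[OF norm_ge_zero K[of a]] by simp
  have "norm y \<le> (K + 1) / cmod D" if y: "y \<in> - im_locus (\<lambda>z1 z2. (z1 + \<i> * z2) * (g * z1 + d * z2) + p * z1 + q * z2 + f = 0)" for y
  proof (rule ccontr)
    assume n: "\<not> norm y \<le> (K + 1) / cmod D"
    define Y where "Y = Complex (fst y) (- snd y)"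
    define C where "C = D * Y"
    have "norm y = cmod Y" unfolding Y_def norm_prod_def complex_norm by simp
    then have "(K + 1) / cmod D < cmod Y" using n by simp
    then have "K + 1 < cmod C"
      using Dnz by (simp add: C_def norm_mult pos_divide_less_eq mult.commute)
    then have C: "K \<le> cmod C" "C \<noteq> 0" using K0 by auto
    have cont: "continuous_on (cball a 1) (\<lambda>u. a + N u / C)" by (intro continuous_intros cN) (simp add: C)
    have maps: "(\<lambda>u. a + N u / C) \<in> cball a 1 \<rightarrow> cball a 1"
    proof
      fix u assume "u \<in> cball a 1"
      then have "cmod (N u) / cmod C \<le> 1" using K[of u] C by (simp add: divide_le_eq_1)
      then show "a + N u / C \<in> cball a 1" by (simp add: dist_norm norm_divide)
    qed
    obtain u where u: "a + N u / C = u"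
      by (rule brouwer_ball[OF zero_less_one cont maps])
    then have "N u / C = u - a" unfolding eq_diff_eq by (simp add: add.commute)
    then have eq: "N u = C * (u - a)" using C(2) by (simp add: nonzero_divide_eq_eq mult.commute)
    have "D * a = - (\<i> * p - q)" using Dnz by (simp add: a_def)
    moreover have "C * a = (D * a) * Y" by (simp add: C_def)
    ultimately have Ca: "C * a = - (\<i> * p - q) * Y" by simp
    define z1 where "z1 = Complex (Re u + snd y) (fst y)"
    define z2 where "z2 = Complex (Im u - fst y) (snd y)"
    have z: "z1 + \<i> * z2 = u" by (simp add: z1_def z2_def complex_eq_iff)
    have z1: "z1 = of_real (Re u) + \<i> * Y" and z2: "z2 = of_real (Im u) - Y"
      by (simp_all add: z1_def z2_def Y_def complex_eq_iff)
    have "g * z1 + d * z2 = L u + C" "p * z1 + q * z2 = P u + (\<i> * p - q) * Y"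
      by (simp_all add: z1 z2 L_def P_def C_def D_def algebra_simps)
    then have "(z1 + \<i> * z2) * (g * z1 + d * z2) + p * z1 + q * z2 + f
        = u * (L u + C) + (P u + (\<i> * p - q) * Y) + f"
      unfolding z add.assoc[of "u * (g * z1 + d * z2)"] by simp
    also have "\<dots> = C * u - C * a - N u" unfolding Ca N_def by (simp add: algebra_simps)
    also have "\<dots> = 0" unfolding eq by (simp add: algebra_simps)
    finally have root: "(z1 + \<i> * z2) * (g * z1 + d * z2) + p * z1 + q * z2 + f = 0" .
    have "y = (Im z1, Im z2)" by (simp add: z1_def z2_def)
    then have "y \<in> im_locus (\<lambda>z1 z2. (z1 + \<i> * z2) * (g * z1 + d * z2) + p * z1 + q * z2 + f = 0)"
      unfolding im_locus_def using root by blast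
    then show False using y by blast
  qed
  then show ?thesis by (rule boundedI)
qed

text \<open>With \<open>v = (x - ei / 2) + \<i> * b\<close> the shift absorbs \<open>ei\<close>, and
  the imaginary part of the equation reads \<open>2 * x * b = mi\<close>. For
  \<open>mi \<noteq> 0\<close> this eliminates \<open>b\<close>; the real part becomes a function
  \<phi> of \<open>x > 0\<close> that tends to minus infinity at 0 and to plus infinity at infinity,
  so the intermediate value theorem applies.\<close>

lemma square_plus_Im_surj:
  fixes e M :: complex
  shows "\<exists>v. v\<^sup>2 + e * of_real (Im v) = M"
proof -
  define er ei mr mi where c: "er = Re e" "ei = Im e" "mr = Re M" "mi = Im M"
  have "\<exists>x b. (x - ei / 2)\<^sup>2 - b\<^sup>2 + er * b = mr \<and> 2 * x * b = mi"
  proof (cases "mi = 0")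
    case True
    \<comment> \<open>For \<open>mi = 0\<close> either \<open>b\<close> or \<open>x\<close>
      vanishes: \<open>b = 0\<close> serves \<open>mr \<ge> 0\<close>, and otherwise
      \<open>x = 0\<close> leaves a quadratic in \<open>b\<close> with positive
      discriminant.\<close>
    show ?thesis
    proof (cases "0 \<le> mr")
      case mr: True
      show ?thesis by (intro exI[of _ "sqrt mr + ei / 2"] exI[of _ 0]) (use True mr in simp)
    next
      case False
      define r where "r = sqrt (er\<^sup>2 + ei\<^sup>2 - 4 * mr)"
      have "0 \<le> er\<^sup>2 + ei\<^sup>2 - 4 * mr" using False zero_le_power2[of er] zero_le_power2[of ei] by linarith
      then have r: "r\<^sup>2 = er\<^sup>2 + ei\<^sup>2 - 4 * mr" by (simp add: r_def)
      have "(0 - ei / 2)\<^sup>2 - ((er + r) / 2)\<^sup>2 + er * ((er + r) / 2) = (ei\<^sup>2 + er\<^sup>2 - r\<^sup>2) / 4"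
        by (simp add: power2_eq_square field_simps)
      also have "\<dots> = mr" unfolding r by simp
      finally show ?thesis using True by (intro exI[of _ 0] exI[of _ "(er + r) / 2"]) simp
    qed
  next
    case False
    define \<phi> where "\<phi> x = (x - ei / 2)\<^sup>2 - (mi / (2 * x))\<^sup>2 + er * (mi / (2 * x))" for x
    \<comment> \<open>\<open>x1\<close> is chosen to make the size of \<open>b\<close> equal to
      \<beta>, and \<beta> is large enough for its square to dominate
      \<open>\<bar>er\<bar> * \<beta>\<close> and \<open>c1\<close>, which bounds the remaining
      terms since \<open>x1 \<le> 1\<close>.\<close>
    define c1 where "c1 = (1 + \<bar>ei\<bar>)\<^sup>2 + \<bar>mr\<bar>"
    define \<beta> where "\<beta> = 1 + \<bar>mi\<bar> + \<bar>er\<bar> + c1"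
    define x1 where "x1 = \<bar>mi\<bar> / (2 * \<beta>)"
    have c1: "0 \<le> c1" by (simp add: c1_def)
    then have \<beta>: "1 \<le> \<beta>" "\<bar>mi\<bar> \<le> \<beta>" by (auto simp: \<beta>_def)
    have x1: "0 < x1" "x1 \<le> 1" using \<beta> False by (auto simp: x1_def divide_le_eq_1)
    \<comment> \<open>For \<open>x \<ge> 1\<close> the size of \<open>b\<close> is at most that of
      \<open>mi\<close>, so \<open>c2\<close> controls the terms in \<open>b\<close> together with
      \<open>mr\<close>; \<open>x2\<close> makes the square dominate its linear term by at least
      \<open>c2\<close>.\<close>
    define c2 where "c2 = mi\<^sup>2 + \<bar>er * mi\<bar> + \<bar>mr\<bar>"
    define x2 where "x2 = 1 + \<bar>ei\<bar> + c2"
    have c2: "0 \<le> c2" by (simp add: c2_def)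
    then have x2: "1 \<le> x2" by (simp add: x2_def)
    have "\<phi> x1 \<le> mr"
    proof -
      have b: "\<bar>mi / (2 * x1)\<bar> = \<beta>" using \<beta> False by (simp add: x1_def abs_mult)
      have "(mi / (2 * x1))\<^sup>2 = \<beta>\<^sup>2" using b by (metis power2_abs)
      moreover have "er * (mi / (2 * x1)) \<le> \<bar>er\<bar> * \<beta>"
        using abs_ge_self[of "er * (mi / (2 * x1))"] unfolding abs_mult[of er] b .
      moreover have "(x1 - ei / 2)\<^sup>2 \<le> (1 + \<bar>ei\<bar>)\<^sup>2"
        by (rule abs_le_square_iff[THEN iffD1]) (use x1 in linarith)
      moreover have "c1 \<le> \<beta> * (1 + \<bar>mi\<bar> + c1)"
        using mult_mono[of 1 \<beta> c1 "1 + \<bar>mi\<bar> + c1"] \<beta> c1 by simp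
      then have "c1 \<le> \<beta>\<^sup>2 - \<bar>er\<bar> * \<beta>" by (simp add: \<beta>_def power2_eq_square algebra_simps)
      ultimately show ?thesis unfolding \<phi>_def c1_def by linarith
    qed
    moreover have "mr \<le> \<phi> x2"
    proof -
      have q: "\<bar>mi / (2 * x2)\<bar> \<le> \<bar>mi\<bar>"
      proof -
        have "\<bar>mi\<bar> * 1 \<le> \<bar>mi\<bar> * (2 * x2)" by (rule mult_left_mono) (use x2 in auto)
        then show ?thesis using x2 by (simp add: abs_mult divide_le_eq)
      qed
      then have "(mi / (2 * x2))\<^sup>2 \<le> mi\<^sup>2" by (simp only: abs_le_square_iff)
      moreover have "- \<bar>er * mi\<bar> \<le> er * (mi / (2 * x2))"
      proof -
        have "\<bar>er * (mi / (2 * x2))\<bar> \<le> \<bar>er * mi\<bar>" unfolding abs_mult[of er] by (rule mult_left_mono[OF q]) simp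
        then show ?thesis by linarith
      qed
      moreover have "c2 \<le> x2 * (1 + c2)" using mult_mono[of 1 x2 c2 "1 + c2"] x2 c2 by simp
      then have "c2 \<le> x2\<^sup>2 - \<bar>ei\<bar> * x2" by (simp add: x2_def power2_eq_square algebra_simps)
      moreover have "(x2 - ei / 2)\<^sup>2 = x2\<^sup>2 - ei * x2 + (ei / 2)\<^sup>2" by (simp add: power2_eq_square field_simps)
      moreover have "ei * x2 \<le> \<bar>ei\<bar> * x2" using x2 by (intro mult_right_mono) auto
      moreover have "0 \<le> (ei / 2)\<^sup>2" by simp
      ultimately show ?thesis unfolding \<phi>_def c2_def by linarith
    qed
    moreover have "continuous_on {x1..x2} \<phi>"
      unfolding \<phi>_def using x1 by (intro continuous_intros) auto
    ultimately obtain x where x: "x1 \<le> x" "\<phi> x = mr" using IVT'[of \<phi> x1 mr x2] x1 x2 by auto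
    then show ?thesis using x1
      by (intro exI[of _ x] exI[of _ "mi / (2 * x)"]) (auto simp: \<phi>_def)
  qed
  then obtain x b where xb: "(x - ei / 2)\<^sup>2 - b\<^sup>2 + er * b = mr" "2 * x * b = mi" by blast
  have "(Complex (x - ei / 2) b)\<^sup>2 + e * of_real (Im (Complex (x - ei / 2) b)) = M"
    using xb by (simp add: complex_eq_iff c power2_eq_square algebra_simps)
  then show ?thesis ..
qed

text \<open>In the coordinates \<open>u\<close> and \<open>Y\<close> from the bounded case, writing
  \<open>Re u\<close> as \<open>u - \<i> * Im u\<close> leaves \<open>Im u\<close> as the only term
  not polynomial in \<open>u\<close>. Completing the square with \<open>v = u + h\<close> gives the
  equation of \<open>square_plus_Im_surj\<close>.\<close>

lemma nonreal_square_full: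
  assumes K: "K \<noteq> 0"
  shows "- im_locus (\<lambda>z1 z2. K * (z1 + \<i> * z2)\<^sup>2 + p * z1 + q * z2 + f = 0) = {}"
proof -
  have "y \<in> im_locus (\<lambda>z1 z2. K * (z1 + \<i> * z2)\<^sup>2 + p * z1 + q * z2 + f = 0)" for y
  proof -
    define Y where "Y = Complex (fst y) (- snd y)"
    define h where "h = p / (2 * K)"
    define E where "E = (q - \<i> * p) / K"
    obtain v where v: "v\<^sup>2 + E * of_real (Im v) = h\<^sup>2 + E * of_real (Im h) - ((\<i> * p - q) * Y + f) / K"
      using square_plus_Im_surj by blast
    define u where "u = v - h"
    define z1 where "z1 = Complex (Re u + snd y) (fst y)"
    define z2 where "z2 = Complex (Im u - fst y) (snd y)"
    have z: "z1 + \<i> * z2 = u" by (simp add: z1_def z2_def complex_eq_iff)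
    have z1: "z1 = of_real (Re u) + \<i> * Y" and z2: "z2 = of_real (Im u) - Y"
      by (simp_all add: z1_def z2_def Y_def complex_eq_iff)
    have re: "complex_of_real (Re u) = u - \<i> * of_real (Im u)" by (simp add: complex_eq_iff)
    have KE: "K * E = q - \<i> * p" "2 * K * h = p" using K by (simp_all add: E_def h_def)
    have "K * (z1 + \<i> * z2)\<^sup>2 + p * z1 + q * z2 + f = K * u\<^sup>2 + p * u + (q - \<i> * p) * of_real (Im u) + ((\<i> * p - q) * Y + f)"
      unfolding z by (simp add: z1 z2 re algebra_simps)
    also have "\<dots> = K * u\<^sup>2 + (2 * K * h) * u + (K * E) * of_real (Im u) + ((\<i> * p - q) * Y + f)"
      unfolding KE ..
    also have "\<dots> = K * (v\<^sup>2 + E * of_real (Im v) - h\<^sup>2 - E * of_real (Im h)) + ((\<i> * p - q) * Y + f)"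
      by (simp add: u_def power2_eq_square algebra_simps)
    also have "\<dots> = 0" unfolding v using K by simp
    finally have root: "K * (z1 + \<i> * z2)\<^sup>2 + p * z1 + q * z2 + f = 0" .
    have "y = (Im z1, Im z2)" by (simp add: z1_def z2_def)
    then show ?thesis unfolding im_locus_def using root by blast
  qed
  then show ?thesis by blast
qed

subsection \<open>Reduction to normal forms\<close>

definition conic_locus :: "complex \<Rightarrow> complex \<Rightarrow> complex \<Rightarrow> complex \<Rightarrow> complex \<Rightarrow> complex \<Rightarrow> (real \<times> real) set" where
  "conic_locus a b c d e f =
    im_locus (\<lambda>z1 z2. a * z1\<^sup>2 + b * z1 * z2 + c * z2\<^sup>2 + d * z1 + e * z2 + f = 0)"

lemma quadratic_form_factor:
  fixes a b c :: complex
  obtains \<alpha> \<beta> \<gamma> \<delta> where "a = \<alpha> * \<gamma>" "b = \<alpha> * \<delta> + \<beta> * \<gamma>" "c = \<beta> * \<delta>"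
proof (cases "a = 0")
  case True
  then show ?thesis using that[of 0 b c 1] by simp
next
  case False
  define r where "r = csqrt (b\<^sup>2 - 4 * a * c)"
  have r: "r\<^sup>2 = b\<^sup>2 - 4 * a * c" by (simp add: r_def)
  have "(b - r) / 2 * ((b + r) / (2 * a)) = (b\<^sup>2 - r\<^sup>2) / (4 * a)"
    by (simp add: power2_eq_square algebra_simps)
  also have "\<dots> = c" unfolding r using False by simp
  finally have "c = (b - r) / 2 * ((b + r) / (2 * a))" by simp
  moreover have "b = a * ((b + r) / (2 * a)) + (b - r) / 2 * 1" using False by (simp add: field_simps)
  ultimately show ?thesis using that[of a 1 "(b + r) / (2 * a)" "(b - r) / 2"] by simp
qed

text \<open>The scalar \<open>k\<close> is complex: what matters is whether the ratio of the two
  coefficients is real, so that the form cuts out a real line up to scaling.\<close>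

lemma linear_form_cases:
  fixes \<alpha> \<beta> :: complex
  assumes "\<alpha> \<noteq> 0 \<or> \<beta> \<noteq> 0"
  obtains (real) k and r s :: real where "k \<noteq> 0" "\<alpha> = k * of_real r" "\<beta> = k * of_real s" "r \<noteq> 0 \<or> s \<noteq> 0"
  | (nonreal) r s :: real where "\<alpha> \<noteq> 0" "s \<noteq> 0" "\<beta> = \<alpha> * (of_real r + \<i> * of_real s)"
proof (cases "\<alpha> = 0")
  case True
  then show ?thesis using assms real[of \<beta> 0 1] by simp
next
  case False
  define t where "t = \<beta> / \<alpha>"
  have \<beta>: "\<beta> = \<alpha> * t" using False by (simp add: t_def)
  have t: "t = of_real (Re t) + \<i> * of_real (Im t)" by (simp add: complex_eq_iff)
  show ?thesis
  proof (cases "Im t = 0")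
    case True
    then have "t = of_real (Re t)" by (simp add: complex_eq_iff)
    then show ?thesis using real[of \<alpha> 1 "Re t"] False \<beta> by simp
  next
    case im: False
    show ?thesis using nonreal[of "Im t" "Re t"] False im \<beta> t by simp
  qed
qed

lemma conic_real_lines:
  fixes r1 s1 r2 s2 :: real
  assumes D: "r1 * s2 - s1 * r2 \<noteq> 0" and k: "k \<noteq> 0"
    and abc: "a = k * (of_real r1 * of_real r2)" "b = k * (of_real r1 * of_real s2 + of_real s1 * of_real r2)"
      "c = k * (of_real s1 * of_real s2)"
  obtains w where "aff_eq (- conic_locus a b c d e f) (- mult_locus w)"
    and "\<lbrakk>a \<in> \<real>; b \<in> \<real>; c \<in> \<real>; d \<in> \<real>; e \<in> \<real>; f \<in> \<real>\<rbrakk> \<Longrightarrow> w \<in> \<real>"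
proof -
  define D' :: complex where "D' = of_real r1 * of_real s2 - of_real s1 * of_real r2"
  have D': "D' \<noteq> 0" unfolding D'_def using D by (simp flip: of_real_mult of_real_diff)
  \<comment> \<open>\<open>d'\<close> and \<open>e'\<close> are the coordinates of the linear part
    in the basis of the two line forms. Shifting each form by the coefficient of the other, divided
    by \<open>k\<close>, then absorbs the linear part into the product.\<close>
  define d' where "d' = (d * of_real s2 - e * of_real r2) / D'"
  define e' where "e' = (e * of_real r1 - d * of_real s1) / D'"
  have "d' * of_real r1 + e' * of_real r2 = d * D' / D'" "d' * of_real s1 + e' * of_real s2 = e * D' / D'"
    unfolding d'_def e'_def by (simp_all add: D'_def add_divide_distrib diff_divide_distrib algebra_simps)
  then have de: "d = d' * of_real r1 + e' * of_real r2" "e = d' * of_real s1 + e' * of_real s2"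
    using D' by simp_all
  define w where "w = (e' / k) * (d' / k) - f / k"
  have id: "k * ((X + e' / k) * (Y + d' / k) - w) = k * (X * Y) + d' * X + e' * Y + f" for X Y
    using k by (simp add: w_def algebra_simps)
  show thesis
  proof (rule that)
    show "aff_eq (- conic_locus a b c d e f) (- mult_locus w)"
      unfolding conic_locus_def mult_locus_def
    proof (rule im_locus_affine[where ?k1.0 = "e' / k" and ?k2.0 = "d' / k", OF D])
      fix z1 z2 :: complex
      have "a * z1\<^sup>2 + b * z1 * z2 + c * z2\<^sup>2 + d * z1 + e * z2 + f
        = k * ((of_real r1 * z1 + of_real s1 * z2) * (of_real r2 * z1 + of_real s2 * z2))
          + d' * (of_real r1 * z1 + of_real s1 * z2) + e' * (of_real r2 * z1 + of_real s2 * z2) + f"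
        unfolding abc de by (simp add: power2_eq_square algebra_simps)
      also have "\<dots> = k * ((of_real r1 * z1 + of_real s1 * z2 + e' / k) * (of_real r2 * z1 + of_real s2 * z2 + d' / k) - w)"
        by (rule id[symmetric])
      finally show "a * z1\<^sup>2 + b * z1 * z2 + c * z2\<^sup>2 + d * z1 + e * z2 + f = 0 \<longleftrightarrow>
        (of_real r1 * z1 + of_real s1 * z2 + e' / k) * (of_real r2 * z1 + of_real s2 * z2 + d' / k) = w"
        using k by simp
    qed
  next
    assume R: "a \<in> \<real>" "b \<in> \<real>" "c \<in> \<real>" "d \<in> \<real>" "e \<in> \<real>" "f \<in> \<real>"
    have "k \<in> \<real>"
    proof -
      have *: "k \<in> \<real>" if "k * of_real t \<in> \<real>" "t \<noteq> 0" for t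
      proof -
        have "k * of_real t / of_real t \<in> \<real>" using that(1) by (intro Reals_divide) simp_all
        then show ?thesis using that(2) by simp
      qed
      \<comment> \<open>The scalar comes from a complex factorization, so its reality must be read
        off a coefficient. The three real products cannot all vanish, because the determinant does
        not.\<close>
      have "r1 * r2 \<noteq> 0 \<or> s1 * s2 \<noteq> 0 \<or> r1 * s2 + s1 * r2 \<noteq> 0" using D by auto
      then show ?thesis
        using R(1-3) *[of "r1 * r2"] *[of "s1 * s2"] *[of "r1 * s2 + s1 * r2"] unfolding abc by auto
    qed
    moreover have "D' \<in> \<real>" unfolding D'_def by simp
    then have "d' \<in> \<real>" "e' \<in> \<real>" unfolding d'_def e'_def using R by simp_all
    ultimately show "w \<in> \<real>" unfolding w_def using R by simp
  qed
qed

lemma conic_real_double_line: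
  fixes r s :: real
  assumes rs: "r \<noteq> 0 \<or> s \<noteq> 0" and k: "k \<noteq> 0"
    and abc: "a = k * (of_real r)\<^sup>2" "b = k * (2 * of_real r * of_real s)" "c = k * (of_real s)\<^sup>2"
  obtains w where "aff_eq (- conic_locus a b c d e f) (- square_locus w)"
  | g where "g \<noteq> 0" "aff_eq (- conic_locus a b c d e f) (- parabola_locus g)"
      "\<lbrakk>a \<in> \<real>; b \<in> \<real>; c \<in> \<real>; d \<in> \<real>; e \<in> \<real>; f \<in> \<real>\<rbrakk> \<Longrightarrow> g \<in> \<real>"
proof -
  \<comment> \<open>The second coordinate is the form \<open>- s * z1 + r * z2\<close>,
    perpendicular to the double line's form; the determinant is then a sum of squares.\<close>
  have D: "r * r - s * - s \<noteq> 0" using rs by (simp add: sum_squares_eq_zero_iff)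
  define D' :: complex where "D' = of_real r * of_real r + of_real s * of_real s"
  have D': "D' \<noteq> 0" unfolding D'_def using D by (simp flip: of_real_mult of_real_add)
  define d' where "d' = (d * of_real r + e * of_real s) / D'"
  define e' where "e' = (e * of_real r - d * of_real s) / D'"
  have "d' * of_real r - e' * of_real s = d * D' / D'" "d' * of_real s + e' * of_real r = e * D' / D'"
    unfolding d'_def e'_def by (simp_all add: D'_def add_divide_distrib diff_divide_distrib algebra_simps)
  then have de: "d = d' * of_real r - e' * of_real s" "e = d' * of_real s + e' * of_real r"
    using D' by simp_all
  define h where "h = d' / (2 * k)"
  have h: "d' = 2 * k * h" using k by (simp add: h_def)
  have eq: "a * z1\<^sup>2 + b * z1 * z2 + c * z2\<^sup>2 + d * z1 + e * z2 + f
    = k * (of_real r * z1 + of_real s * z2 + h)\<^sup>2 + e' * (of_real (- s) * z1 + of_real r * z2) + (f - k * h\<^sup>2)"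
    for z1 z2
    unfolding abc de h by (simp add: power2_eq_square algebra_simps)
  show thesis
  \<comment> \<open>\<open>e'\<close> is the coefficient of the linear part transverse to the double
    form: without it the second variable disappears, with it the equation can be solved for that
    variable.\<close>
  proof (cases "e' = 0")
    case True
    define w where "w = - (f - k * h\<^sup>2) / k"
    have "aff_eq (- conic_locus a b c d e f) (- square_locus w)"
      unfolding conic_locus_def square_locus_def
    proof (rule im_locus_affine[where ?k1.0 = h and ?k2.0 = 0, OF D])
      fix z1 z2 :: complex
      show "a * z1\<^sup>2 + b * z1 * z2 + c * z2\<^sup>2 + d * z1 + e * z2 + f = 0 \<longleftrightarrow>
        (of_real r * z1 + of_real s * z2 + h)\<^sup>2 = w"
        unfolding eq True w_def using k by (simp add: field_simps add_eq_0_iff) 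
    qed
    then show thesis by (rule that(1))
  next
    case False
    define g where "g = - k / e'"
    define l where "l = (f - k * h\<^sup>2) / e'"
    have g0: "g \<noteq> 0" using k False by (simp add: g_def)
    have "aff_eq (- conic_locus a b c d e f) (- parabola_locus g)"
      unfolding conic_locus_def parabola_locus_def
    proof (rule im_locus_affine[where ?k1.0 = h and ?k2.0 = l, OF D])
      fix z1 z2 :: complex
      have "k * X\<^sup>2 + e' * Y + (f - k * h\<^sup>2) = e' * (Y + l - g * X\<^sup>2)" for X Y
      proof -
        have "e' * l = f - k * h\<^sup>2" "e' * g = - k" using False by (simp_all add: g_def l_def)
        moreover have "e' * (Y + l - g * X\<^sup>2) = e' * Y + e' * l - (e' * g) * X\<^sup>2"
          by (simp add: algebra_simps)
        ultimately show ?thesis by simp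
      qed
      then show "a * z1\<^sup>2 + b * z1 * z2 + c * z2\<^sup>2 + d * z1 + e * z2 + f = 0 \<longleftrightarrow>
        of_real (- s) * z1 + of_real r * z2 + l = g * (of_real r * z1 + of_real s * z2 + h)\<^sup>2"
        unfolding eq using False by simp
    qed
    moreover have "g \<in> \<real>" if R: "a \<in> \<real>" "b \<in> \<real>" "c \<in> \<real>" "d \<in> \<real>" "e \<in> \<real>" "f \<in> \<real>"
    proof -
      \<comment> \<open>The trace \<open>a + c\<close> of the quadratic form equals \<open>k\<close>
        times the real number \<open>r\<^sup>2 + s\<^sup>2\<close>.\<close>
      have "k = (a + c) / D'" using D' by (simp add: abc D'_def power2_eq_square flip: distrib_left)
      moreover have "D' \<in> \<real>" unfolding D'_def by simp
      ultimately have "k \<in> \<real>" "e' \<in> \<real>" unfolding e'_def using R by simp_all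
      then show ?thesis unfolding g_def by simp
    qed
    ultimately show thesis using g0 that(2) by blast
  qed
qed

lemma unbounded_parts_bounded:
  assumes "bounded S" shows "unbounded_parts S = {}"
  unfolding unbounded_parts_def using assms bounded_subset in_components_subset by blast

lemma aff_eq_unbounded_parts_empty:
  assumes "aff_eq S T" "unbounded_parts T = {}"
  shows "unbounded_parts S = {}"
  using aff_eq_parts(1,3)[OF assms(1)] assms(2) by simp

text \<open>In the real coordinates \<open>z1 + of_real r * z2\<close> and
  \<open>of_real s * z2\<close> the nonreal factor becomes \<alpha> times the first coordinate plus
  \<i> times the second. The other factor is either independent of it or proportional to it, and the
  latter means \<open>\<delta>' = \<i> * \<gamma>\<close>.\<close>

lemma conic_nonreal_line:
  fixes r s :: real
  assumes s: "s \<noteq> 0" and \<alpha>: "\<alpha> \<noteq> 0" and \<beta>: "\<beta> = \<alpha> * (of_real r + \<i> * of_real s)"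
    and abc: "a = \<alpha> * \<gamma>" "b = \<alpha> * \<delta> + \<beta> * \<gamma>" "c = \<beta> * \<delta>" and nz: "\<gamma> \<noteq> 0 \<or> \<delta> \<noteq> 0"
  shows "unbounded_parts (- conic_locus a b c d e f) = {}"
proof -
  define \<delta>' where "\<delta>' = (\<delta> - \<gamma> * of_real r) / of_real s"
  define e' where "e' = (e - d * of_real r) / of_real s"
  have \<delta>: "\<delta> = \<gamma> * of_real r + \<delta>' * of_real s" and e: "e = d * of_real r + e' * of_real s"
    using s by (simp_all add: \<delta>'_def e'_def)
  have D: "1 * s - r * 0 \<noteq> 0" using s by simp
  let ?Q = "\<lambda>z1 z2. (z1 + \<i> * z2) * ((\<alpha> * \<gamma>) * z1 + (\<alpha> * \<delta>') * z2) + d * z1 + e' * z2 + f = 0"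
  have aff: "aff_eq (- conic_locus a b c d e f) (- im_locus ?Q)"
    unfolding conic_locus_def
  proof (rule im_locus_affine[where ?k1.0 = 0 and ?k2.0 = 0, OF D])
    fix z1 z2 :: complex
    have "a * z1\<^sup>2 + b * z1 * z2 + c * z2\<^sup>2 + d * z1 + e * z2 + f =
      ((z1 + of_real r * z2) + \<i> * (of_real s * z2)) * ((\<alpha> * \<gamma>) * (z1 + of_real r * z2) + (\<alpha> * \<delta>') * (of_real s * z2))
        + d * (z1 + of_real r * z2) + e' * (of_real s * z2) + f"
      unfolding abc \<beta> \<delta> e by (simp add: power2_eq_square algebra_simps)
    then show "a * z1\<^sup>2 + b * z1 * z2 + c * z2\<^sup>2 + d * z1 + e * z2 + f = 0 \<longleftrightarrow>
      ?Q (of_real 1 * z1 + of_real r * z2 + 0) (of_real 0 * z1 + of_real s * z2 + 0)" by simp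
  qed
  have "unbounded_parts (- im_locus ?Q) = {}"
  proof (cases "\<delta>' = \<i> * \<gamma>")
    case False
    then have "\<i> * (\<alpha> * \<gamma>) - \<alpha> * \<delta>' \<noteq> 0" using \<alpha> by (simp add: mult.left_commute)
    then show ?thesis by (intro unbounded_parts_bounded nonreal_factor_bounded)
  next
    case True
    have "\<gamma> \<noteq> 0" using nz True \<delta> by auto
    have "(z1 + \<i> * z2) * ((\<alpha> * \<gamma>) * z1 + (\<alpha> * \<delta>') * z2) = (\<alpha> * \<gamma>) * (z1 + \<i> * z2)\<^sup>2" for z1 z2
      unfolding True by (simp add: power2_eq_square algebra_simps)
    then have "- im_locus ?Q = {}"
      using nonreal_square_full[of "\<alpha> * \<gamma>" d e' f] \<alpha> \<open>\<gamma> \<noteq> 0\<close> by simp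
    then show ?thesis by (simp add: unbounded_parts_bounded)
  qed
  then show ?thesis using aff aff_eq_unbounded_parts_empty by blast
qed

text \<open>Reality of the parameter is carried along where the counts depend on it: it limits the
  strictly convex regions of a hyperbola and forces two rays for a parabola.\<close>

lemma conic_normal_form:
  fixes a b c d e f :: complex
  assumes nz: "a \<noteq> 0 \<or> b \<noteq> 0 \<or> c \<noteq> 0"
  obtains (hyperbola) w where "aff_eq (- conic_locus a b c d e f) (- mult_locus w)"
      "\<lbrakk>a \<in> \<real>; b \<in> \<real>; c \<in> \<real>; d \<in> \<real>; e \<in> \<real>; f \<in> \<real>\<rbrakk> \<Longrightarrow> w \<in> \<real>"
  | (double_line) w where "aff_eq (- conic_locus a b c d e f) (- square_locus w)"
  | (parabola) g where "g \<noteq> 0" "aff_eq (- conic_locus a b c d e f) (- parabola_locus g)"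
      "\<lbrakk>a \<in> \<real>; b \<in> \<real>; c \<in> \<real>; d \<in> \<real>; e \<in> \<real>; f \<in> \<real>\<rbrakk> \<Longrightarrow> g \<in> \<real>"
  | (elliptic) "unbounded_parts (- conic_locus a b c d e f) = {}"
proof -
  obtain \<alpha> \<beta> \<gamma> \<delta> where fac: "a = \<alpha> * \<gamma>" "b = \<alpha> * \<delta> + \<beta> * \<gamma>" "c = \<beta> * \<delta>"
    by (rule quadratic_form_factor)
  have nz1: "\<alpha> \<noteq> 0 \<or> \<beta> \<noteq> 0" and nz2: "\<gamma> \<noteq> 0 \<or> \<delta> \<noteq> 0" using nz fac by auto
  \<comment> \<open>Swapping the factors lets one lemma treat a nonreal factor in either
    position.\<close>
  have fac': "a = \<gamma> * \<alpha>" "b = \<gamma> * \<beta> + \<delta> * \<alpha>" "c = \<delta> * \<beta>" using fac by (simp_all add: mult.commute add.commute)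
  show thesis using nz1
  proof (cases rule: linear_form_cases)
    case (nonreal r s)
    then show thesis using elliptic conic_nonreal_line[OF nonreal(2,1,3) fac nz2] by blast
  next
    case (real k1 r1 s1)
    note 1 = this
    show thesis using nz2
    proof (cases rule: linear_form_cases)
      case (nonreal r s)
      then show thesis using elliptic conic_nonreal_line[OF nonreal(2,1,3) fac' nz1] by blast
    next
      case (real k2 r2 s2)
      note 2 = this
      show thesis
      proof (cases "r1 * s2 - s1 * r2 = 0")
        case False
        have "k1 * k2 \<noteq> 0" using 1 2 by simp
        moreover have "a = k1 * k2 * (of_real r1 * of_real r2)"
          "b = k1 * k2 * (of_real r1 * of_real s2 + of_real s1 * of_real r2)"
          "c = k1 * k2 * (of_real s1 * of_real s2)"
          unfolding fac 1 2 by (simp_all add: algebra_simps)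
        ultimately show thesis using conic_real_lines[OF False] hyperbola by metis
      next
        case True
        \<comment> \<open>A vanishing determinant makes the two real forms proportional, so the
          ratio joins the scalar and a double line remains.\<close>
        obtain t where t: "t \<noteq> 0" "r2 = t * r1" "s2 = t * s1"
        proof (cases "r1 = 0")
          case True
          then have "s1 \<noteq> 0" using 1 by simp
          then have "r2 = 0" using \<open>r1 * s2 - s1 * r2 = 0\<close> True by simp
          then show ?thesis using that[of "s2 / s1"] True \<open>s1 \<noteq> 0\<close> 2 by simp
        next
          case r1: False
          have "s2 = r2 / r1 * s1" using True r1 by (simp add: field_simps)
          moreover from this have "r2 \<noteq> 0" using 2 by auto
          ultimately show ?thesis using that[of "r2 / r1"] r1 by simp
        qed
        define k where "k = k1 * k2 * of_real t"
        have "k \<noteq> 0" using 1 2 t by (simp add: k_def)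
        moreover have "a = k * (of_real r1)\<^sup>2" "b = k * (2 * of_real r1 * of_real s1)" "c = k * (of_real s1)\<^sup>2"
          unfolding fac 1 2 t k_def by (simp_all add: power2_eq_square algebra_simps)
        ultimately show thesis using conic_real_double_line[OF 1(4)] double_line parabola by metis
      qed
    qed
  qed
qed

lemma mult_locus_real_scale:
  assumes "w \<in> \<real>" "w \<noteq> 0"
  shows "aff_eq (- mult_locus w) (- mult_locus 1)"
proof -
  obtain r where r: "w = of_real r" "r \<noteq> 0" using assms by (auto elim: Reals_cases)
  have D: "(1 / r) * 1 - 0 * 0 \<noteq> 0" using r by simp
  show ?thesis unfolding mult_locus_def
    by (rule im_locus_affine[where ?k1.0 = 0 and ?k2.0 = 0, OF D]) (use r in \<open>auto simp: field_simps\<close>)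
qed

lemma mult_parts:
  "card (unbounded_parts (- mult_locus w)) = 4"
  "w \<in> \<real> \<Longrightarrow> card (strict_parts (- mult_locus w)) \<le> 2"
proof -
  have *: "card (unbounded_parts (- mult_locus w)) = 4 \<and> card (strict_parts (- mult_locus w)) \<le> 2" if "w \<in> \<real>"
    using that mult_parts_zero mult_parts_one aff_eq_parts[OF mult_locus_real_scale[OF that]]
    by (cases "w = 0") simp_all
  then show "w \<in> \<real> \<Longrightarrow> card (strict_parts (- mult_locus w)) \<le> 2" by blast
  show "card (unbounded_parts (- mult_locus w)) = 4" using * mult_parts_nonreal(1) by (cases "w \<in> \<real>") blast+
qed

section \<open>Bounds and attained counts for conic polynomials\<close>

definition conic :: "complex \<Rightarrow> complex \<Rightarrow> complex \<Rightarrow> complex \<Rightarrow> complex \<Rightarrow> complex \<Rightarrow> complex poly poly" where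
  "conic a b c d e f = [:[:f, d, a:], [:e, b:], [:c:]:]"

lemma parts_conic:
  "unbounded_components (conic a b c d e f) = unbounded_parts (- conic_locus a b c d e f)"
  "strictly_convex_unbounded_components (conic a b c d e f) = strict_parts (- conic_locus a b c d e f)"
proof -
  have "imag_proj (conic a b c d e f) = conic_locus a b c d e f"
    unfolding imag_proj_def conic_def eval2_conic conic_locus_def im_locus_def ..
  then show 1: "unbounded_components (conic a b c d e f) = unbounded_parts (- conic_locus a b c d e f)"
    unfolding unbounded_components_def unbounded_parts_def by simp
  show "strictly_convex_unbounded_components (conic a b c d e f) = strict_parts (- conic_locus a b c d e f)"
    unfolding strictly_convex_unbounded_components_def strict_parts_def 1 ..
qed

lemma complex_conicE:
  assumes "complex_conic p"
  obtains a b c d e f where "p = conic a b c d e f" "a \<noteq> 0 \<or> b \<noteq> 0 \<or> c \<noteq> 0"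
  using assms unfolding complex_conic_iff conic_def by blast

lemma complex_conic_conic: "a \<noteq> 0 \<or> b \<noteq> 0 \<or> c \<noteq> 0 \<Longrightarrow> complex_conic (conic a b c d e f)"
  unfolding complex_conic_iff conic_def by blast

lemma coeff2_conic:
  "coeff2 (conic a b c d e f) 2 0 = a" "coeff2 (conic a b c d e f) 1 1 = b" "coeff2 (conic a b c d e f) 0 2 = c"
  "coeff2 (conic a b c d e f) 1 0 = d" "coeff2 (conic a b c d e f) 0 1 = e" "coeff2 (conic a b c d e f) 0 0 = f"
  by (simp_all add: conic_def coeff2_def numeral_2_eq_2)

lemma real_conic_conic:
  "real_conic (conic a b c d e f) \<longleftrightarrow> (a \<noteq> 0 \<or> b \<noteq> 0 \<or> c \<noteq> 0) \<and>
    a \<in> \<real> \<and> b \<in> \<real> \<and> c \<in> \<real> \<and> d \<in> \<real> \<and> e \<in> \<real> \<and> f \<in> \<real>"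
proof
  assume R: "real_conic (conic a b c d e f)"
  then have "complex_conic (conic a b c d e f)" by (simp add: real_conic_def)
  then have "a \<noteq> 0 \<or> b \<noteq> 0 \<or> c \<noteq> 0"
    by (rule complex_conicE) (auto simp: conic_def)
  then show "(a \<noteq> 0 \<or> b \<noteq> 0 \<or> c \<noteq> 0) \<and> a \<in> \<real> \<and> b \<in> \<real> \<and> c \<in> \<real> \<and> d \<in> \<real> \<and> e \<in> \<real> \<and> f \<in> \<real>"
    using R coeff2_conic[of a b c d e f] unfolding real_conic_def by metis
next
  assume "(a \<noteq> 0 \<or> b \<noteq> 0 \<or> c \<noteq> 0) \<and> a \<in> \<real> \<and> b \<in> \<real> \<and> c \<in> \<real> \<and> d \<in> \<real> \<and> e \<in> \<real> \<and> f \<in> \<real>"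
  moreover from this have "complex_conic (conic a b c d e f)" by (simp add: complex_conic_conic)
  ultimately show "real_conic (conic a b c d e f)"
    unfolding real_conic_def
    by (auto simp: conic_def coeff2_def coeff_pCons split: nat.splits)
qed

lemma complex_conic_bounds:
  assumes "complex_conic p"
  shows "finite (unbounded_components p)" "card (unbounded_components p) \<le> 4"
proof -
  obtain a b c d e f where p: "p = conic a b c d e f" and nz: "a \<noteq> 0 \<or> b \<noteq> 0 \<or> c \<noteq> 0"
    using assms by (rule complex_conicE)
  let ?S = "- conic_locus a b c d e f"
  \<comment> \<open>A positive cardinality already entails finiteness, so the range starts at 1; the
    elliptic case is settled by emptiness instead.\<close>
  have *: "finite (unbounded_parts ?S) \<and> card (unbounded_parts ?S) \<le> 4"
    if "aff_eq ?S T" "card (unbounded_parts T) \<in> {1..4}" for T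
    using aff_eq_parts[OF that(1)] that(2) card_ge_0_finite[of "unbounded_parts ?S"] by simp
  have "finite (unbounded_parts ?S) \<and> card (unbounded_parts ?S) \<le> 4"
    using nz
  proof (cases rule: conic_normal_form[of a b c d e f, case_names hyperbola double_line parabola elliptic])
    case (hyperbola w)
    then show ?thesis by (intro *[OF hyperbola(1)]) (simp add: mult_parts)
  next
    case (double_line w)
    then show ?thesis by (intro *[OF double_line]) (simp add: square_parts)
  next
    case (parabola g)
    then show ?thesis
      by (intro *[OF parabola(2)]; cases "g \<in> \<real>") (simp_all add: parabola_parts_real parabola_parts_nonreal)
  qed simp
  then show "finite (unbounded_components p)" "card (unbounded_components p) \<le> 4"
    unfolding p parts_conic by simp_all
qed

text \<open>A count of 1 arises only from a parabola with nonreal \<open>g\<close>, and more than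
  two strictly convex components only from a hyperbola with nonreal \<open>w\<close>; real
  coefficients exclude both.\<close>

lemma real_conic_bounds:
  assumes "real_conic p"
  shows "card (unbounded_components p) \<noteq> 1" "card (strictly_convex_unbounded_components p) \<le> 2"
proof -
  have "complex_conic p" using assms by (simp add: real_conic_def)
  then obtain a b c d e f where p: "p = conic a b c d e f" and nz: "a \<noteq> 0 \<or> b \<noteq> 0 \<or> c \<noteq> 0"
    by (rule complex_conicE)
  have R: "a \<in> \<real>" "b \<in> \<real>" "c \<in> \<real>" "d \<in> \<real>" "e \<in> \<real>" "f \<in> \<real>"
    using assms unfolding p real_conic_conic by blast+
  let ?S = "- conic_locus a b c d e f"
  have *: "card (unbounded_parts ?S) \<noteq> 1 \<and> card (strict_parts ?S) \<le> 2"
    if "aff_eq ?S T" "card (unbounded_parts T) \<noteq> 1" "card (strict_parts T) \<le> 2" for T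
    using aff_eq_parts[OF that(1)] that(2,3) by simp
  have "card (unbounded_parts ?S) \<noteq> 1 \<and> card (strict_parts ?S) \<le> 2"
    using nz
  proof (cases rule: conic_normal_form[of a b c d e f, case_names hyperbola double_line parabola elliptic])
    case (hyperbola w)
    then show ?thesis using R by (intro *[OF hyperbola(1)]) (simp_all add: mult_parts)
  next
    case (double_line w)
    then show ?thesis by (intro *[OF double_line]) (simp_all add: square_parts)
  next
    case (parabola g)
    have c2: "card (unbounded_parts (- parabola_locus g)) = 2"
      using parabola R by (intro parabola_parts_real) blast+
    then have "finite (unbounded_parts (- parabola_locus g))" by (metis card.infinite zero_neq_numeral)
    then have "card (strict_parts (- parabola_locus g)) \<le> 2"
      unfolding c2[symmetric] strict_parts_def by (intro card_mono) auto
    then show ?thesis using c2 by (intro *[OF parabola(2)]) simp_all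
  next
    case elliptic
    then show ?thesis by (simp add: strict_parts_def)
  qed
  then show "card (unbounded_components p) \<noteq> 1" "card (strictly_convex_unbounded_components p) \<le> 2"
    unfolding p parts_conic by simp_all
qed

lemma conic_locus_examples:
  "unbounded_parts (- conic_locus 1 0 1 0 0 0) = {}"
  "conic_locus g 0 0 0 (-1) 0 = parabola_locus g"
  "conic_locus 1 0 0 0 0 (- w) = square_locus w"
  "conic_locus 0 1 0 0 0 (- w) = mult_locus w"
proof -
  show "unbounded_parts (- conic_locus 1 0 1 0 0 0) = {}"
    \<comment> \<open>The factorization of the sum of two squares into \<open>z1 + \<i> * z2\<close>
      and \<open>z1 - \<i> * z2\<close>.\<close>
    by (rule conic_nonreal_line[of 1 1 \<i> 0 _ 1 _ "- \<i>"]) simp_all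
  show "conic_locus g 0 0 0 (-1) 0 = parabola_locus g"
    unfolding conic_locus_def parabola_locus_def by (rule arg_cong[of _ _ im_locus]) (auto simp: fun_eq_iff)
  show "conic_locus 1 0 0 0 0 (- w) = square_locus w" "conic_locus 0 1 0 0 0 (- w) = mult_locus w"
    unfolding conic_locus_def square_locus_def mult_locus_def by simp_all
qed

text \<open>The finiteness conjunct ensures that a cardinality 0 means no unbounded component rather
  than infinitely many.\<close>

theorem corollary5p4:
  shows "(\<forall>p. complex_conic p \<longrightarrow> finite (unbounded_components p)) \<and>
    {card (unbounded_components p) | p. complex_conic p} = {0..4} \<and>
    (\<exists>p. complex_conic p \<and> card (strictly_convex_unbounded_components p) = 4) \<and>
    (\<forall>p. complex_conic p \<longrightarrow> card (strictly_convex_unbounded_components p) \<le> 4) \<and>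
    {card (unbounded_components p) | p. real_conic p} = {0..4} - {1} \<and>
    (\<exists>p. real_conic p \<and> card (strictly_convex_unbounded_components p) = 2) \<and>
    (\<forall>p. real_conic p \<longrightarrow> card (strictly_convex_unbounded_components p) \<le> 2)"
proof -
  note ex = parts_conic conic_locus_examples
  let ?N = "\<lambda>p. card (unbounded_components p)"
  have rc: "complex_conic p" if "real_conic p" for p using that by (simp add: real_conic_def)
  have r0: "real_conic (conic 1 0 1 0 0 0)" "?N (conic 1 0 1 0 0 0) = 0"
    unfolding real_conic_conic ex by simp_all
  \<comment> \<open>The constant is written \<open>- 0\<close>, and \<open>- (- 1)\<close> below, to
    match the pattern \<open>- w\<close> of the example equations.\<close>
  have r2: "real_conic (conic 1 0 0 0 0 (- 0))" "?N (conic 1 0 0 0 0 (- 0)) = 2"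
    unfolding real_conic_conic ex by (simp_all add: square_parts)
  have r3: "real_conic (conic 1 0 0 0 0 (- (- 1)))" "?N (conic 1 0 0 0 0 (- (- 1))) = 3"
    unfolding real_conic_conic ex by (simp_all add: square_parts)
  have r4: "real_conic (conic 0 1 0 0 0 (- 1))" "?N (conic 0 1 0 0 0 (- 1)) = 4"
    "card (strictly_convex_unbounded_components (conic 0 1 0 0 0 (- 1))) = 2"
    unfolding real_conic_conic ex by (simp_all add: mult_parts mult_parts_one)
  have nr: "\<i> \<notin> \<real>" by (simp add: complex_is_Real_iff)
  have c1: "complex_conic (conic \<i> 0 0 0 (-1) 0)" "?N (conic \<i> 0 0 0 (-1) 0) = 1"
    unfolding ex by (simp_all add: complex_conic_conic parabola_parts_nonreal nr)
  have c4: "complex_conic (conic 0 1 0 0 0 (- \<i>))"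
    "card (strictly_convex_unbounded_components (conic 0 1 0 0 0 (- \<i>))) = 4"
    unfolding ex by (simp_all add: complex_conic_conic mult_parts_nonreal nr)
  have R: "{?N p | p. real_conic p} = {0..4} - {1}"
  proof (intro equalityI subsetI)
    fix n assume "n \<in> {?N p | p. real_conic p}"
    then show "n \<in> {0..4} - {1}" using complex_conic_bounds(2) real_conic_bounds(1) rc by auto
  next
    fix n :: nat assume "n \<in> {0..4} - {1}"
    then have "n = 0 \<or> n = 2 \<or> n = 3 \<or> n = 4" by auto
    then show "n \<in> {?N p | p. real_conic p}" using r0 r2 r3 r4 by (metis (mono_tags, lifting) mem_Collect_eq)
  qed
  have C: "{?N p | p. complex_conic p} = {0..4}"
  proof (intro equalityI subsetI)
    fix n assume "n \<in> {?N p | p. complex_conic p}"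
    then show "n \<in> {0..4}" using complex_conic_bounds(2) by auto
  next
    fix n :: nat assume n: "n \<in> {0..4}"
    show "n \<in> {?N p | p. complex_conic p}"
    \<comment> \<open>Every value other than 1 is already attained by real conics; 1 comes from the
      parabola with coefficient \<i>.\<close>
    proof (cases "n = 1")
      case True
      then have "n = ?N (conic \<i> 0 0 0 (-1) 0)" using c1(2) by simp
      then show ?thesis using c1(1) by blast
    next
      case False
      then have "n \<in> {?N p | p. real_conic p}" unfolding R using n by simp
      then show ?thesis using rc by blast
    qed
  qed
  have "card (strictly_convex_unbounded_components p) \<le> 4" if "complex_conic p" for p
  proof -
    have "card (strictly_convex_unbounded_components p) \<le> card (unbounded_components p)"
      unfolding strictly_convex_unbounded_components_def
      by (intro card_mono complex_conic_bounds(1) that) auto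
    then show ?thesis using complex_conic_bounds(2)[OF that] by linarith
  qed
  then show ?thesis using R C complex_conic_bounds(1) real_conic_bounds(2) c4 r4(1,3) by blast
qed

end
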